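(* Let $f_0,f_2$ be positive integers. There exists a toric line arrangement $\mathcal{A}$ in $\mathbb{T}^2$ with exactly $f_0$ vertices and exactly $f_2$ chambers if and only if \[f_0\le f_2\le 2f_0.\] Moreover, for any toric line arrangement, $f_2=f_0$ holds if and only if $\mathcal{A}$ is simple, and $f_2=2f_0$ holds if and only if $\mathcal{A}$ is simplicial.
   Context: Let $\mathbb{T}^2=\mathbb{R}^2/\mathbb{Z}^2$ with quotient (covering) map $\pi:\mathbb{R}^2\to\mathbb{T}^2$. A toric line is the image $\pi(L)$ of a line $L=\{(x,y)\in\mathbb{R}^2: ax+by=c\}$ with $a,b\in\mathbb{Z}$ coprime and $c\in\mathbb{R}$; it is said to be of type $(a,b)$. A toric line arrangement is a finite set $\mathcal{A}=\{l_1,\dots,l_n\}$ of distinct toric lines which is essential, i.e. not all of its lines are of the same type (not all lines are parallel). The vertices of $\mathcal{A}$ are the points of $\mathbb{T}^2$ lying on at least two lines of $\mathcal{A}$; the edges are the connected components of $\bigcup_i l_i$ with the vertices removed; the chambers are the connected components of $\mathbb{T}^2\setminus\bigcup_i l_i$. We write $f_0,f_1,f_2$ for the numbers of vertices, edges and chambers. The degree of a vertex is the number of lines of $\mathcal{A}$ passing through it. $\mathcal{A}$ is simple if every vertex has degree $2$ (no three lines pass through a common point). A subset $C\subseteq\mathbb{T}^2$ is a toric $k$-gon if there is a $k$-gon $C_0\subset\mathbb{R}^2$ with $\pi(C_0)=C$ such that the restriction of $\pi$ to the interior of $C_0$ is a homeomorphism onto its image (each chamber of an essential arrangement is a toric $k$-gon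 for a unique $k\ge3$). $\mathcal{A}$ is simplicial if every chamber is a toric $3$-gon (triangle). *)

theory Defs
  imports "HOL-Analysis.Analysis"
begin

text \<open>Model of the torus T^2 = R^2/Z^2 as the product of two unit circles in C x C;
  the covering map sends (x,y) to (exp(2 pi i x), exp(2 pi i y)).\<close>

definition torus_map :: "real \<times> real \<Rightarrow> complex \<times> complex" where
  "torus_map p = (cis (2 * pi * fst p), cis (2 * pi * snd p))"

definition torus :: "(complex \<times> complex) set" where
  "torus = range torus_map"

definition toric_line :: "int \<Rightarrow> int \<Rightarrow> real \<Rightarrow> (complex \<times> complex) set" where
  "toric_line a b c = torus_map ` {p. real_of_int a * fst p + real_of_int b * snd p = c}"

definition is_toric_line :: "(complex \<times> complex) set \<Rightarrow> bool" where
  "is_toric_line l \<longleftrightarrow> (\<exists>a b c. coprime a b \<and> l = toric_line a b c)"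

text \<open>A toric line arrangement: a finite set of (distinct) toric lines, essential,
  i.e. not all lines are of the same type (not all parallel).\<close>
definition toric_arrangement :: "(complex \<times> complex) set set \<Rightarrow> bool" where
  "toric_arrangement A \<longleftrightarrow> finite A \<and> (\<forall>l\<in>A. is_toric_line l) \<and>
     (\<exists>l1\<in>A. \<exists>l2\<in>A. \<exists>a1 b1 c1 a2 b2 c2.
        coprime a1 b1 \<and> coprime a2 b2 \<and>
        l1 = toric_line a1 b1 c1 \<and> l2 = toric_line a2 b2 c2 \<and>
        \<not> ((a1 = a2 \<and> b1 = b2) \<or> (a1 = - a2 \<and> b1 = - b2)))"

definition vertices :: "(complex \<times> complex) set set \<Rightarrow> (complex \<times> complex) set" where
  "vertices A = {p. \<exists>l1\<in>A. \<exists>l2\<in>A. l1 \<noteq> l2 \<and> p \<in> l1 \<and> p \<in> l2}"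

definition chambers :: "(complex \<times> complex) set set \<Rightarrow> (complex \<times> complex) set set" where
  "chambers A = components (torus - \<Union>A)"

definition vertex_degree :: "(complex \<times> complex) set set \<Rightarrow> complex \<times> complex \<Rightarrow> nat" where
  "vertex_degree A p = card {l\<in>A. p \<in> l}"

definition simple_arrangement :: "(complex \<times> complex) set set \<Rightarrow> bool" where
  "simple_arrangement A \<longleftrightarrow> (\<forall>p\<in>vertices A. vertex_degree A p = 2)"

text \<open>An (open) k-gon in R^2: the interior of the convex hull of k points in strictly
  convex position (no point lies in the convex hull of the others).\<close>
definition is_kgon :: "nat \<Rightarrow> (real \<times> real) set \<Rightarrow> bool" where
  "is_kgon k C0 \<longleftrightarrow> (\<exists>P. finite P \<and> card P = k \<and>
      (\<forall>q\<in>P. q \<notin> convex hull (P - {q})) \<and> C0 = interior (convex hull P))"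

definition toric_kgon :: "nat \<Rightarrow> (complex \<times> complex) set \<Rightarrow> bool" where
  "toric_kgon k C \<longleftrightarrow> (\<exists>C0. is_kgon k C0 \<and> torus_map ` C0 = C \<and>
      (\<exists>g. homeomorphism (interior C0) (torus_map ` interior C0) torus_map g))"

definition simplicial_arrangement :: "(complex \<times> complex) set set \<Rightarrow> bool" where
  "simplicial_arrangement A \<longleftrightarrow> (\<forall>C\<in>chambers A. toric_kgon 3 C)"

end

theory Submission
  imports Defs
begin

text \<open>
  Every chamber lifts to a bounded convex polygon, an intersection of open strips between
  consecutive lifts of the lines. Measure heights along a direction of irrational slope, so that
  no line is horizontal. Each polygon then has a unique lowest corner, and among the \<open>2 d\<close> sectors
  at a vertex of degree \<open>d\<close> exactly \<open>d - 1\<close> lie above it; hence \<open>f2\<close> is the sum of all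
  \<open>d - 1\<close>, which gives \<open>f0 \<le> f2\<close> with equality precisely for simple arrangements.
  The two sectors at a vertex that contain a horizontal ray are side corners, i.e. corners which
  are neither lowest nor highest in their polygon. A \<open>k\<close>-gon has \<open>k - 2 \<ge> 1\<close> side corners, so the
  \<open>2 f0\<close> side corners map onto the chambers, and injectively iff all chambers are triangles.
\<close>

text \<open>Orienting every equation so that its form grows along the horizontal direction gives all
  lifted lines a left and a right side simultaneously. A cell is then coded by one integer per line:
  the lift at level \<open>n l\<close> bounds it on the left, the lift at level
  \<open>n l + 1\<close> on the right. Lowest, highest and side corners are told apart by which
  kinds of bounds are attained there and, if both kinds are, by comparing slopes; floors and
  ceilings of the forms at a point write down the codes of the cells around it. Integer translations
  of the plane add integers to the codes, and chambers are nonempty cells modulo these translations.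
  Because the arrangement is essential, no nonzero translation fixes a code, so the covering map is
  injective on each cell and counts in the plane pass to the torus. The definition of a toric
  triangle offers only some triangle with the right image; before its corners can be counted it has
  to be identified with a cell, which again rests on this injectivity.\<close>

section \<open>Auxiliary facts on integers, finite maxima, one-sided limits and components\<close>

lemma coprime_cross_eq_cases:
  fixes a b a' b' :: int
  assumes "coprime a b" "coprime a' b'" "a * b' = a' * b"
  shows "a = a' \<and> b = b' \<or> a = - a' \<and> b = - b'"
proof -
  have "a dvd a'"
    using assms(3) coprime_dvd_mult_left_iff[OF assms(1)] by (metis dvd_triv_left)
  moreover have "a' dvd a"
    using assms(3) coprime_dvd_mult_left_iff[OF assms(2)] by (metis dvd_triv_left)
  moreover have "b dvd b'"
    using assms(3) coprime_dvd_mult_right_iff[of b a] assms(1)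
    by (simp add: coprime_commute) (metis dvd_triv_right)
  moreover have "b' dvd b"
    using assms(3) coprime_dvd_mult_right_iff[of b' a'] assms(2)
    by (simp add: coprime_commute) (metis dvd_triv_right)
  ultimately have "\<bar>a\<bar> = \<bar>a'\<bar>" "\<bar>b\<bar> = \<bar>b'\<bar>" by (blast intro: zdvd_antisym_abs)+
  then have "a = a' \<or> a = - a'" "b = b' \<or> b = - b'" by (simp_all only: abs_eq_iff)
  then consider "a = a'" "b = b'" | "a = - a'" "b = - b'" | "a = a'" "b = - b'" | "a = - a'" "b = b'"
    by metis
  then show ?thesis
  proof cases
    case 3
    with assms(3) have "a' * b' = 0" by simp
    with 3 show ?thesis by auto
  next
    case 4
    with assms(3) have "a' * b' = 0" by simp
    with 4 show ?thesis by auto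
  qed auto
qed

lemma between_consecutive_ints_not_Ints:
  fixes x :: real
  assumes "of_int n < x" "x < of_int n + 1" shows "x \<notin> \<int>"
proof
  assume "x \<in> \<int>"
  then obtain k where "x = of_int k" by (auto elim: Ints_cases)
  with assms have "of_int n < (of_int k :: real)" "of_int k < (of_int (n + 1) :: real)" by simp_all
  then have "n < k" "k < n + 1" by (simp_all only: of_int_less_iff)
  then show False by simp
qed

lemma finite_obtains_maximum:
  fixes f :: "'a \<Rightarrow> real"
  assumes "finite S" "S \<noteq> {}"
  obtains m where "m \<in> S" "\<And>y. y \<in> S \<Longrightarrow> f y \<le> f m"
proof -
  have "Max (f ` S) \<in> f ` S" using assms by (intro Max_in) auto
  then obtain m where m: "m \<in> S" "Max (f ` S) = f m" by blast
  have "f y \<le> f m" if "y \<in> S" for y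
    unfolding m(2) [symmetric] using assms(1) that by (intro Max_ge) auto
  with m(1) show ?thesis by (rule that)
qed

text \<open>Source of the term \<open>d - 1\<close>: with \<open>f = slope\<close> and
  \<open>S\<close> the lines through a vertex, every line except the one leaning furthest to the
  right has a sector on its right above the vertex.\<close>

lemma card_not_maximal:
  fixes f :: "'a \<Rightarrow> real"
  assumes "finite S" "S \<noteq> {}" "inj_on f S"
  shows "card {x \<in> S. \<exists>y\<in>S. f x < f y} = card S - 1"
proof -
  obtain m where m: "m \<in> S" "\<And>y. y \<in> S \<Longrightarrow> f y \<le> f m"
    using finite_obtains_maximum[OF assms(1,2)] by metis
  have "{x \<in> S. \<exists>y\<in>S. f x < f y} = S - {m}"
  proof (intro equalityI subsetI)
    fix x assume "x \<in> {x \<in> S. \<exists>y\<in>S. f x < f y}"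
    then show "x \<in> S - {m}" using m(2) by force
  next
    fix x assume x: "x \<in> S - {m}"
    then have "f x \<noteq> f m" using assms(3) m(1) by (auto dest: inj_onD)
    then have "f x < f m" using m(2)[of x] x by simp
    then show "x \<in> {x \<in> S. \<exists>y\<in>S. f x < f y}" using x m(1) by blast
  qed
  then show ?thesis using m(1) by simp
qed

text \<open>For short steps from a point: a slack bound survives in any direction, a tight one if
  the rate of change \<open>\<delta>\<close> has the right sign.\<close>

lemma eventually_less_add_mult:
  fixes x y \<delta> :: real
  assumes "y < x \<or> y = x \<and> 0 < \<delta>"
  shows "\<forall>\<^sub>F r in at_right 0. y < x + r * \<delta>"
  using assms
proof
  assume "y < x"
  moreover have "((\<lambda>r. x + r * \<delta>) \<longlongrightarrow> x) (at_right 0)" by (auto intro!: tendsto_eq_intros)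
  ultimately show ?thesis by (intro order_tendstoD(1))
next
  assume "y = x \<and> 0 < \<delta>"
  then show ?thesis using eventually_at_right_less[of "0::real"] by (auto elim!: eventually_mono)
qed

lemma eventually_le_add_mult:
  fixes x y \<delta> :: real
  assumes "y < x \<or> y = x \<and> 0 \<le> \<delta>"
  shows "\<forall>\<^sub>F r in at_right 0. y \<le> x + r * \<delta>"
proof (cases "y < x")
  case True
  then show ?thesis using eventually_less_add_mult[of y x \<delta>] by (auto elim: eventually_mono)
next
  case False
  then show ?thesis using assms eventually_at_right_less[of "0::real"] by (auto elim!: eventually_mono)
qed

text \<open>The complement of one piece is the union of the other, open, pieces. Each piece is
  therefore clopen in \<open>S\<close>, and a connected subset of \<open>S\<close> that meets it
  cannot leave it.\<close>

lemma components_eqI_openin: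
  assumes disj: "\<And>C D. C \<in> \<C> \<Longrightarrow> D \<in> \<C> \<Longrightarrow> C \<inter> D \<noteq> {} \<Longrightarrow> C = D"
    and cover: "\<Union>\<C> = S"
    and opn: "\<And>C. C \<in> \<C> \<Longrightarrow> openin (top_of_set S) C"
    and conn: "\<And>C. C \<in> \<C> \<Longrightarrow> connected C"
    and nonempty: "\<And>C. C \<in> \<C> \<Longrightarrow> C \<noteq> {}"
  shows "components S = \<C>"
proof -
  have *: "connected_component_set S x = C" if C: "C \<in> \<C>" "x \<in> C" for C x
  proof (rule connected_component_unique)
    show "x \<in> C" "C \<subseteq> S" "connected C" using that cover conn by auto
    fix T assume T: "x \<in> T" "T \<subseteq> S" "connected T"
    have "openin (top_of_set S) (\<Union>(\<C> - {C}))" using opn by blast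
    moreover have "S - C = \<Union>(\<C> - {C})" using cover disj that(1) by blast
    ultimately have "closedin (top_of_set S) C"
      using cover that(1) by (auto simp: closedin_def)
    then obtain Q where "closed Q" "C = S \<inter> Q" unfolding closedin_closed by blast
    moreover obtain G where "open G" "C = S \<inter> G" using opn[OF C(1)] unfolding openin_open by metis
    ultimately have "T \<inter> C = T \<inter> Q" "T \<inter> C = T \<inter> G" "closed Q" "open G" using T(2) by auto
    then have "closedin (top_of_set T) (T \<inter> C)" "openin (top_of_set T) (T \<inter> C)"
      unfolding closedin_closed openin_open by blast+
    then show "T \<subseteq> C" using T that unfolding connected_clopen by blast
  qed
  show ?thesis
  proof (intro equalityI subsetI)
    fix C assume "C \<in> components S"
    then obtain x where "x \<in> S" "C = connected_component_set S x" by (auto simp: components_iff)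
    then show "C \<in> \<C>" using * cover by auto
  next
    fix C assume "C \<in> \<C>"
    then show "C \<in> components S" using * nonempty cover components_iff by (metis UnionI ex_in_conv)
  qed
qed

text \<open>Irrationality of \<open>sqrt 2\<close> by the usual parity argument. It says that no
  toric line is horizontal, so each equation can be oriented by a change of sign.\<close>

lemma coprime_add_sqrt2_neq_0:
  assumes "coprime a b"
  shows "real_of_int a + of_int b * sqrt 2 \<noteq> 0"
proof
  assume "real_of_int a + of_int b * sqrt 2 = 0"
  then have "real_of_int a ^ 2 = (of_int b * sqrt 2) ^ 2" by (simp add: add_eq_0_iff)
  then have "real_of_int (a ^ 2) = of_int (2 * b ^ 2)" by (simp add: power_mult_distrib)
  then have sq: "a ^ 2 = 2 * b ^ 2" by (simp only: of_int_eq_iff)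
  then have "even a" by (metis dvd_triv_left even_power pos2)
  then obtain k where "a = 2 * k" ..
  with sq have "b ^ 2 = 2 * k ^ 2" by (simp add: power_mult_distrib)
  then have "even b" by (metis dvd_triv_left even_power pos2)
  with \<open>even a\<close> assms show False by (metis coprime_common_divisor odd_one)
qed

section \<open>The covering map and toric lines\<close>

lemma cis_2pi_eq_iff: "cis (2 * pi * x) = cis (2 * pi * y) \<longleftrightarrow> (\<exists>n::int. y = x + of_int n)"
proof
  assume "cis (2 * pi * x) = cis (2 * pi * y)"
  then have "exp (\<i> * complex_of_real (2 * pi * y)) = exp (\<i> * complex_of_real (2 * pi * x))"
    by (simp add: cis_conv_exp)
  then obtain n :: int where
    "\<i> * complex_of_real (2 * pi * y) = \<i> * complex_of_real (2 * pi * x) + (of_int (2 * n) * pi) * \<i>"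
    unfolding exp_eq by blast
  then have "2 * pi * y = 2 * pi * x + of_int (2 * n) * pi"
    by (simp add: complex_eq_iff)
  then have "(2 * pi) * y = (2 * pi) * (x + of_int n)"
    by (simp add: algebra_simps)
  then have "y = x + of_int n" by simp
  then show "\<exists>n::int. y = x + of_int n" ..
next
  assume "\<exists>n::int. y = x + of_int n"
  then obtain n :: int where "y = x + of_int n" ..
  then have "2 * pi * y = 2 * pi * x + 2 * pi * of_int n"
    by (simp add: algebra_simps)
  then show "cis (2 * pi * x) = cis (2 * pi * y)"
    by (simp add: cis_mult [symmetric] cis_multiple_2pi)
qed

lemma torus_map_eq_iff:
  "torus_map p = torus_map q \<longleftrightarrow> (\<exists>m n::int. q = p + (of_int m, of_int n))"
  by (cases p; cases q) (auto simp: torus_map_def cis_2pi_eq_iff)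

lemma torus_map_add_int [simp]: "torus_map (p + (of_int m, of_int n)) = torus_map p"
  using torus_map_eq_iff by metis

lemma continuous_on_torus_map [continuous_intros]: "continuous_on S torus_map"
  unfolding torus_map_def by (intro continuous_intros)

lemma torus_map_open_map:
  assumes "open D"
  shows "openin (top_of_set torus) (torus_map ` D)"
proof (subst openin_subopen, intro ballI)
  fix r assume "r \<in> torus_map ` D"
  then obtain p where p: "p \<in> D" "r = torus_map p" by blast
  \<comment> \<open>A section of the covering map, continuous near \<open>r\<close>: division by the
    coordinates of \<open>r\<close> moves them to 1, away from the branch cut of
    \<open>Arg\<close>.\<close>
  define g where "g = (\<lambda>q :: complex \<times> complex.
    (fst p + Arg (fst q / cis (2 * pi * fst p)) / (2 * pi),
     snd p + Arg (snd q / cis (2 * pi * snd p)) / (2 * pi)))"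
  have A1: "isCont Arg 1"
    by (intro continuous_at_Arg) (simp add: complex_nonpos_Reals_iff)
  have "isCont g r"
  proof -
    have "isCont (\<lambda>q. Arg (fst q / cis (2 * pi * fst p))) r"
      by (rule isCont_o2[where g = Arg], intro continuous_intros) (simp_all add: p A1 torus_map_def)
    moreover have "isCont (\<lambda>q. Arg (snd q / cis (2 * pi * snd p))) r"
      by (rule isCont_o2[where g = Arg], intro continuous_intros) (simp_all add: p A1 torus_map_def)
    ultimately show ?thesis unfolding g_def by (intro continuous_intros) simp_all
  qed
  moreover have "g r = p"
    by (simp add: g_def p torus_map_def Arg_eq_0)
  ultimately obtain T where T: "open T" "r \<in> T" "\<And>q. q \<in> T \<Longrightarrow> g q \<in> D"
    using assms p(1) unfolding continuous_at_open by metis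
  have "torus_map (g q) = q" if "q \<in> torus" for q
  proof -
    from that have q: "norm (fst q) = 1" "norm (snd q) = 1"
      by (auto simp: torus_def torus_map_def)
    have *: "cis (2 * pi * (x + Arg (z / cis (2 * pi * x)) / (2 * pi))) = z"
      if "norm z = 1" for x :: real and z :: complex
    proof -
      have nz: "z / cis (2 * pi * x) \<noteq> 0" using that by auto
      have "norm (z / cis (2 * pi * x)) = 1" using that by (simp add: norm_divide)
      then have "cis (Arg (z / cis (2 * pi * x))) = z / cis (2 * pi * x)"
        using cis_Arg[OF nz] by (simp add: sgn_div_norm)
      moreover have "2 * pi * (x + Arg (z / cis (2 * pi * x)) / (2 * pi))
          = 2 * pi * x + Arg (z / cis (2 * pi * x))"
        by (simp add: field_simps)
      ultimately show ?thesis by (simp add: cis_mult [symmetric])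
    qed
    show ?thesis using * q by (simp add: torus_map_def g_def prod_eq_iff)
  qed
  then have "torus \<inter> T \<subseteq> torus_map ` D"
    using T(3) by (metis IntE image_eqI subsetI)
  moreover have "openin (top_of_set torus) (torus \<inter> T)" using T(1) by blast
  moreover have "r \<in> torus \<inter> T" using T(2) p by (simp add: torus_def)
  ultimately show "\<exists>T. openin (top_of_set torus) T \<and> r \<in> T \<and> T \<subseteq> torus_map ` D" by blast
qed

text \<open>Coprimality is what makes the image of a single line lift to the union of all its
  parallels with constant term in \<open>c + \<int>\<close>.\<close>
lemma torus_map_in_toric_line_iff:
  assumes "coprime a b"
  shows "torus_map p \<in> toric_line a b c \<longleftrightarrow> of_int a * fst p + of_int b * snd p - c \<in> \<int>"
proof
  assume "torus_map p \<in> toric_line a b c"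
  then obtain q where q: "of_int a * fst q + of_int b * snd q = c" "torus_map q = torus_map p"
    by (auto simp: toric_line_def)
  then obtain m n :: int where "p = q + (of_int m, of_int n)" by (auto simp: torus_map_eq_iff)
  then have "of_int a * fst p + of_int b * snd p - c = of_int (a * m + b * n)"
    using q(1) by (simp add: algebra_simps)
  then show "of_int a * fst p + of_int b * snd p - c \<in> \<int>" by (metis Ints_of_int)
next
  assume "of_int a * fst p + of_int b * snd p - c \<in> \<int>"
  then obtain k :: int where k: "of_int a * fst p + of_int b * snd p - c = of_int k"
    by (auto elim: Ints_cases)
  \<comment> \<open>A Bezout pair supplies the integer translation that lowers the level of the line
    by exactly \<open>k\<close>.\<close>
  obtain u v :: int where "u * a + v * b = 1"
    using assms bezout_int[of a b] by auto
  then have "a * (k * u) + b * (k * v) = k" by algebra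
  then have "real_of_int a * of_int (k * u) + of_int b * of_int (k * v) = of_int k"
    by (metis of_int_add of_int_mult)
  then have "of_int a * fst (p + (of_int (- k * u), of_int (- k * v)))
      + of_int b * snd (p + (of_int (- k * u), of_int (- k * v))) = c"
    using k by (simp add: algebra_simps)
  then have "torus_map (p + (of_int (- k * u), of_int (- k * v))) \<in> toric_line a b c"
    unfolding toric_line_def by blast
  then show "torus_map p \<in> toric_line a b c" by (simp only: torus_map_add_int)
qed

lemma toric_line_subset_torus: "toric_line a b c \<subseteq> torus"
  by (auto simp: toric_line_def torus_def)

lemma toric_line_uminus: "toric_line (- a) (- b) (- c) = toric_line a b c"
proof -
  have "{p. real_of_int (- a) * fst p + real_of_int (- b) * snd p = - c}
      = {p. real_of_int a * fst p + real_of_int b * snd p = c}"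
    by auto
  then show ?thesis by (simp only: toric_line_def)
qed

text \<open>Along a line with normal \<open>(a, b)\<close> the form with normal
  \<open>(a', b')\<close> changes at a constant rate, the determinant \<open>D\<close>. If it only
  takes values in a coset of the integers, the rate must vanish.\<close>

lemma toric_line_eq_imp_parallel:
  assumes "coprime a b" "coprime a' b'" "toric_line a b c = toric_line a' b' c'"
  shows "a * b' = a' * b"
proof (rule ccontr)
  assume ne: "a * b' \<noteq> a' * b"
  define D where "D = real_of_int (a * b' - a' * b)"
  have D: "D \<noteq> 0" unfolding D_def using ne by (metis eq_iff_diff_eq_0 of_int_0_eq_iff)
  define N where "N = real_of_int a ^ 2 + real_of_int b ^ 2"
  have N: "N \<noteq> 0"
    using assms(1) by (auto simp: N_def add_nonneg_eq_0_iff)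
  \<comment> \<open>The foot of the perpendicular from the origin, moved by \<open>r\<close> times
    the direction \<open>(- b, a)\<close>.\<close>
  define p where "p r = (of_int a * c / N - r * of_int b, of_int b * c / N + r * of_int a)" for r :: real
  have "real_of_int a * fst (p r) + of_int b * snd (p r) = c" for r
  proof -
    have "real_of_int a * fst (p r) + of_int b * snd (p r) = c * N / N"
      by (simp add: p_def N_def algebra_simps power2_eq_square add_divide_distrib)
    then show ?thesis using N by simp
  qed
  then have "torus_map (p r) \<in> toric_line a b c" for r
    unfolding toric_line_def by (intro imageI CollectI)
  then have "torus_map (p r) \<in> toric_line a' b' c'" for r
    by (simp only: assms(3))
  then have *: "of_int a' * fst (p r) + of_int b' * snd (p r) - c' \<in> \<int>" for r
    using torus_map_in_toric_line_iff[OF assms(2)] by blast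
  have "(of_int a' * fst (p r) + of_int b' * snd (p r) - c')
      - (of_int a' * fst (p 0) + of_int b' * snd (p 0) - c') = r * D" for r
    by (simp add: p_def D_def algebra_simps)
  then have "r * D \<in> \<int>" for r using Ints_diff[OF * *] by metis
  \<comment> \<open>This parameter makes the form change by one half.\<close>
  from this[of "1 / (2 * D)"] have "(1 / 2 :: real) \<in> \<int>" using D by (simp add: field_simps)
  then obtain k :: int where "(1 / 2 :: real) = of_int k" by (auto elim: Ints_cases)
  then have "real_of_int (2 * k) = of_int 1" by simp
  then have "2 * k = 1" by (simp only: of_int_eq_iff)
  then show False by presburger
qed

section \<open>Cells of the lifted arrangement\<close>

text \<open>Its level lines have the direction \<open>(1, sqrt 2)\<close>, which is what
  "horizontal" means throughout.\<close>

definition height :: "real \<times> real \<Rightarrow> real" where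
  "height p = snd p - sqrt 2 * fst p"

lemma height_add_scaleR: "height (p + r *\<^sub>R d) = height p + r * height d"
  by (simp add: height_def algebra_simps)

lemma height_diff: "height (p - q) = height p - height q"
  by (simp add: height_def algebra_simps)

text \<open>The lines of \<open>A\<close> with their equations, oriented by the direction \<open>(1, sqrt 2)\<close>, which no
  line with integer coefficients can have.\<close>
locale oriented_arrangement =
  fixes A :: "(complex \<times> complex) set set"
    and a b :: "(complex \<times> complex) set \<Rightarrow> int"
    and c :: "(complex \<times> complex) set \<Rightarrow> real"
  assumes finite_A: "finite A"
    and coprime_ab: "l \<in> A \<Longrightarrow> coprime (a l) (b l)"
    and oriented: "l \<in> A \<Longrightarrow> 0 < of_int (a l) + of_int (b l) * sqrt 2"
    and line_eq: "l \<in> A \<Longrightarrow> l = toric_line (a l) (b l) (c l)"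
    and essential: "\<exists>l\<in>A. \<exists>l'\<in>A. a l * b l' \<noteq> a l' * b l"
begin

definition lin :: "(complex \<times> complex) set \<Rightarrow> real \<times> real \<Rightarrow> real" where
  "lin l d = of_int (a l) * fst d + of_int (b l) * snd d"

definition form :: "(complex \<times> complex) set \<Rightarrow> real \<times> real \<Rightarrow> real" where
  "form l p = lin l p - c l"

text \<open>This is \<open>lin l\<close> on the horizontal direction \<open>(1, sqrt 2)\<close>, and
  also the height of the vector \<open>(- b l, a l)\<close> along the line. Being positive, it makes
  the form grow to the right.\<close>

definition weight :: "(complex \<times> complex) set \<Rightarrow> real" where
  "weight l = of_int (a l) + of_int (b l) * sqrt 2"

text \<open>The change of the first coordinate per unit of height along the line, so an inverse
  slope: the larger it is, the further the line leans to the right on its way up.\<close>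

definition slope :: "(complex \<times> complex) set \<Rightarrow> real" where
  "slope l = - of_int (b l) / weight l"

definition cell :: "((complex \<times> complex) set \<Rightarrow> int) \<Rightarrow> (real \<times> real) set" where
  "cell n = {p. \<forall>l\<in>A. of_int (n l) < form l p \<and> form l p < of_int (n l) + 1}"

definition closed_cell :: "((complex \<times> complex) set \<Rightarrow> int) \<Rightarrow> (real \<times> real) set" where
  "closed_cell n = {p. \<forall>l\<in>A. of_int (n l) \<le> form l p \<and> form l p \<le> of_int (n l) + 1}"

lemma weight_pos: "l \<in> A \<Longrightarrow> 0 < weight l"
  using oriented by (simp add: weight_def)

text \<open>While the height grows by \<open>height d\<close>, the line itself moves sideways by
  \<open>slope l * height d\<close>; up to the factor \<open>weight l\<close>, the form measures the
  signed horizontal distance from it.\<close>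

lemma lin_eq_slope:
  assumes "l \<in> A" shows "lin l d = weight l * (fst d - slope l * height d)"
proof -
  have "weight l * slope l = - of_int (b l)" using weight_pos[OF assms] by (simp add: slope_def)
  then have "weight l * (fst d - slope l * height d) = weight l * fst d + of_int (b l) * height d"
    by (simp add: right_diff_distrib flip: mult.assoc)
  then show ?thesis by (simp add: lin_def weight_def height_def algebra_simps)
qed

lemma form_add_scaleR: "form l (p + r *\<^sub>R d) = form l p + r * lin l d"
  by (simp add: form_def lin_def algebra_simps)

lemma form_diff: "form l p - form l q = lin l (p - q)"
  by (simp add: form_def lin_def algebra_simps)

lemma form_add_int:
  "form l (p + (of_int i, of_int j)) = form l p + of_int (a l * i + b l * j)"
  by (simp add: form_def lin_def algebra_simps)

lemma torus_map_in_line_iff: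
  assumes "l \<in> A" shows "torus_map p \<in> l \<longleftrightarrow> form l p \<in> \<int>"
  using torus_map_in_toric_line_iff[OF coprime_ab[OF assms], of p "c l"]
  unfolding line_eq[OF assms, symmetric] form_def lin_def .

lemma line_subset_torus: "l \<in> A \<Longrightarrow> l \<subseteq> torus"
  using line_eq toric_line_subset_torus by metis

text \<open>Parallel lines that meet coincide. Equal slopes give equal normals, the orientation
  settling the sign, and at the common point \<open>p\<close> the two forms differ by an
  integer.\<close>

lemma slope_inj:
  assumes l: "l \<in> A" "l' \<in> A" and "form l p \<in> \<int>" "form l' p \<in> \<int>" "slope l = slope l'"
  shows "l = l'"
proof -
  have "of_int (b l) * weight l' = of_int (b l') * weight l"
    using assms(5) weight_pos[OF l(1)] weight_pos[OF l(2)] by (simp add: slope_def field_simps)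
  then have "real_of_int (a l * b l') = of_int (a l' * b l)"
    by (simp add: weight_def algebra_simps)
  then have "a l * b l' = a l' * b l" by (simp only: of_int_eq_iff)
  then have "a l = a l' \<and> b l = b l' \<or> a l = - a l' \<and> b l = - b l'"
    by (intro coprime_cross_eq_cases coprime_ab l)
  then have ab: "a l = a l'" "b l = b l'" using oriented[OF l(1)] oriented[OF l(2)] by auto
  have *: "form l q - form l' q = form l p - form l' p" for q
    using ab by (simp add: form_def lin_def)
  have "form l q \<in> \<int> \<longleftrightarrow> form l' q \<in> \<int>" for q
  proof -
    have "form l q = form l' q + (form l p - form l' p)" "form l' q = form l q + (form l' p - form l p)"
      using *[of q] by simp_all
    then show ?thesis using assms(3,4) by (metis Ints_add Ints_diff)
  qed
  then have "torus_map q \<in> l \<longleftrightarrow> torus_map q \<in> l'" for q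
    using torus_map_in_line_iff l by blast
  then show ?thesis using line_subset_torus[OF l(1)] line_subset_torus[OF l(2)]
    by (auto simp: torus_def)
qed

lemma lin_eq_0_imp:
  assumes "l \<in> A" "l' \<in> A" "slope l \<noteq> slope l'" "lin l d = 0" "lin l' d = 0"
  shows "d = 0"
proof -
  have "fst d = slope l * height d" "fst d = slope l' * height d"
    using assms weight_pos[of l] weight_pos[of l'] by (auto simp: lin_eq_slope)
  then have "height d = 0" "fst d = 0" using assms(3) by auto
  then show ?thesis by (simp add: height_def prod_eq_iff)
qed

lemma exists_slopes_neq: "\<exists>l\<in>A. \<exists>l'\<in>A. slope l \<noteq> slope l'"
proof -
  obtain l l' where l: "l \<in> A" "l' \<in> A" "a l * b l' \<noteq> a l' * b l" using essential by blast
  have "slope l \<noteq> slope l'"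
  proof
    assume "slope l = slope l'"
    then have "of_int (b l) * weight l' = of_int (b l') * weight l"
      using weight_pos[OF l(1)] weight_pos[OF l(2)] by (simp add: slope_def field_simps)
    then have "real_of_int (a l * b l') = of_int (a l' * b l)"
      by (simp add: weight_def algebra_simps)
    then show False using l(3) by (simp only: of_int_eq_iff)
  qed
  then show ?thesis using l by blast
qed

lemma cell_subset_closed_cell: "cell n \<subseteq> closed_cell n"
  by (auto simp: cell_def closed_cell_def less_imp_le)

lemma cell_cong: "(\<And>l. l \<in> A \<Longrightarrow> n l = n' l) \<Longrightarrow> cell n = cell n'"
  by (auto simp: cell_def)

lemma polyhedron_closed_cell: "polyhedron (closed_cell n)"
proof -
  have "closed_cell n = (\<Inter>l\<in>A. {p. (of_int (a l), of_int (b l)) \<bullet> p \<le> of_int (n l) + 1 + c l}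
      \<inter> {p. (of_int (a l), of_int (b l)) \<bullet> p \<ge> of_int (n l) + c l})"
    by (auto simp: closed_cell_def form_def lin_def inner_prod_def algebra_simps)
  also have "polyhedron \<dots>"
    using finite_A by (intro polyhedron_Inter polyhedron_Int finite_imageI)
      (auto intro!: polyhedron_Int polyhedron_halfspace_le polyhedron_halfspace_ge)
  finally show ?thesis .
qed

lemma convex_closed_cell: "convex (closed_cell n)"
  by (rule polyhedron_imp_convex[OF polyhedron_closed_cell])

lemma open_cell: "open (cell n)"
proof -
  have "cell n = (\<Inter>l\<in>A. {p. of_int (n l) < form l p} \<inter> {p. form l p < of_int (n l) + 1})"
    by (auto simp: cell_def)
  also have "open \<dots>"
    using finite_A unfolding form_def lin_def
    by (intro open_INT ballI open_Int open_Collect_less continuous_intros) auto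
  finally show ?thesis .
qed

lemma convex_cell: "convex (cell n)"
proof -
  have "cell n = (\<Inter>l\<in>A. {p. (of_int (a l), of_int (b l)) \<bullet> p < of_int (n l) + 1 + c l}
      \<inter> {p. (of_int (a l), of_int (b l)) \<bullet> p > of_int (n l) + c l})"
    by (auto simp: cell_def form_def lin_def inner_prod_def algebra_simps)
  also have "convex \<dots>"
    by (intro convex_INT convex_Int convex_halfspace_lt convex_halfspace_gt)
  finally show ?thesis .
qed

text \<open>Two non-parallel strips already bound the cell: Cramer's rule recovers both coordinates
  from two forms, and the determinant is a nonzero integer, hence at least 1 in absolute
  value.\<close>

lemma compact_closed_cell: "compact (closed_cell n)"
proof -
  obtain l l' where l: "l \<in> A" "l' \<in> A" "a l * b l' \<noteq> a l' * b l" using essential by blast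
  define D where "D = a l * b l' - a l' * b l"
  have "1 \<le> \<bar>D\<bar>" using l(3) unfolding D_def by linarith
  then have "real_of_int 1 \<le> of_int \<bar>D\<bar>" by (simp only: of_int_le_iff)
  then have D: "1 \<le> \<bar>real_of_int D\<bar>" by simp
  define M where "M k = \<bar>real_of_int (n k)\<bar> + 1 + \<bar>c k\<bar>" for k
  have M: "\<bar>lin k p\<bar> \<le> M k" if "k \<in> A" "p \<in> closed_cell n" for k p
  proof -
    have "of_int (n k) \<le> lin k p - c k" "lin k p - c k \<le> of_int (n k) + 1"
      using that by (auto simp: closed_cell_def form_def)
    then show ?thesis unfolding M_def by linarith
  qed
  have bd: "\<bar>z\<bar> \<le> \<bar>\<beta>\<bar> * M k + \<bar>\<gamma>\<bar> * M k'"
    if "of_int D * z = \<beta> * lin k p + \<gamma> * lin k' p" "k \<in> A" "k' \<in> A" "p \<in> closed_cell n"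
    for z \<beta> \<gamma> k k' p
  proof -
    have "\<bar>z\<bar> \<le> \<bar>of_int D\<bar> * \<bar>z\<bar>" using D by (simp add: mult_le_cancel_right1)
    also have "\<dots> = \<bar>\<beta> * lin k p + \<gamma> * lin k' p\<bar>" using that(1) by (simp flip: abs_mult)
    also have "\<dots> \<le> \<bar>\<beta>\<bar> * \<bar>lin k p\<bar> + \<bar>\<gamma>\<bar> * \<bar>lin k' p\<bar>" by (metis abs_mult abs_triangle_ineq)
    also have "\<dots> \<le> \<bar>\<beta>\<bar> * M k + \<bar>\<gamma>\<bar> * M k'"
      using M that(2-) by (intro add_mono mult_left_mono) auto
    finally show ?thesis .
  qed
  define B where "B = (\<bar>of_int (b l')\<bar> * M l + \<bar>- of_int (b l)\<bar> * M l')
      + (\<bar>- of_int (a l')\<bar> * M l + \<bar>of_int (a l)\<bar> * M l')"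
  have "norm p \<le> B" if "p \<in> closed_cell n" for p
  proof -
    have "of_int D * fst p = of_int (b l') * lin l p + (- of_int (b l)) * lin l' p"
      "of_int D * snd p = (- of_int (a l')) * lin l p + of_int (a l) * lin l' p"
      by (simp_all add: D_def lin_def algebra_simps)
    then have "\<bar>fst p\<bar> + \<bar>snd p\<bar> \<le> B"
      unfolding B_def using bd l(1,2) that by (intro add_mono) blast+
    then show ?thesis using norm_Pair_le[of "fst p" "snd p"] by simp
  qed
  then have "bounded (closed_cell n)" unfolding bounded_iff by blast
  then show ?thesis using polyhedron_imp_closed[OF polyhedron_closed_cell]
    by (simp add: compact_eq_bounded_closed)
qed

text \<open>A short step from \<open>v\<close> along \<open>d\<close> lands in the cell: slack
  bounds survive, and \<open>d\<close> strictly relaxes the tight ones. Finiteness of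
  \<open>A\<close> gives one step length for all lines.\<close>

lemma cell_direction:
  assumes "\<And>l. l \<in> A \<Longrightarrow> of_int (n l) < form l v \<or> of_int (n l) = form l v \<and> 0 < lin l d"
    and "\<And>l. l \<in> A \<Longrightarrow> form l v < of_int (n l) + 1 \<or> form l v = of_int (n l) + 1 \<and> lin l d < 0"
  shows "cell n \<noteq> {}"
proof -
  have "\<forall>\<^sub>F r in at_right 0. \<forall>l\<in>A. of_int (n l) < form l v + r * lin l d
      \<and> - (of_int (n l) + 1) < - form l v + r * (- lin l d)"
  proof (intro eventually_ball_finite finite_A ballI eventually_conj eventually_less_add_mult)
    fix l assume l: "l \<in> A"
    show "of_int (n l) < form l v \<or> of_int (n l) = form l v \<and> 0 < lin l d" by (rule assms(1)[OF l])
    show "- (of_int (n l) + 1) < - form l v \<or> - (of_int (n l) + 1) = - form l v \<and> 0 < - lin l d"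
      using assms(2)[OF l] by linarith
  qed
  then obtain r where "\<forall>l\<in>A. of_int (n l) < form l v + r * lin l d
      \<and> - (of_int (n l) + 1) < - form l v + r * (- lin l d)"
    using eventually_happens' trivial_limit_at_right_real by blast
  then have "v + r *\<^sub>R d \<in> cell n" by (auto simp: cell_def form_add_scaleR)
  then show ?thesis by blast
qed

lemma closed_cell_direction:
  assumes v: "v \<in> closed_cell n"
    and "\<And>l. l \<in> A \<Longrightarrow> form l v = of_int (n l) \<Longrightarrow> 0 \<le> lin l d"
    and "\<And>l. l \<in> A \<Longrightarrow> form l v = of_int (n l) + 1 \<Longrightarrow> lin l d \<le> 0"
  shows "\<forall>\<^sub>F r in at_right 0. v + r *\<^sub>R d \<in> closed_cell n"
proof -
  have "\<forall>\<^sub>F r in at_right 0. \<forall>l\<in>A. of_int (n l) \<le> form l v + r * lin l d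
      \<and> - (of_int (n l) + 1) \<le> - form l v + r * (- lin l d)"
  proof (intro eventually_ball_finite finite_A ballI eventually_conj eventually_le_add_mult)
    fix l assume l: "l \<in> A"
    with v have *: "of_int (n l) \<le> form l v" "form l v \<le> of_int (n l) + 1"
      by (auto simp: closed_cell_def)
    show "of_int (n l) < form l v \<or> of_int (n l) = form l v \<and> 0 \<le> lin l d"
      using * assms(2)[OF l] by linarith
    show "- (of_int (n l) + 1) < - form l v \<or> - (of_int (n l) + 1) = - form l v \<and> 0 \<le> - lin l d"
      using * assms(3)[OF l] by linarith
  qed
  then show ?thesis by eventually_elim (auto simp: closed_cell_def form_add_scaleR)
qed

text \<open>From an interior point one can move a little in both horizontal directions. Every form
  strictly increases along \<open>(1, sqrt 2)\<close>, so neither of its bounds is attained at the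
  point.\<close>

lemma interior_closed_cell: "interior (closed_cell n) = cell n"
proof
  show "cell n \<subseteq> interior (closed_cell n)"
    by (intro interior_maximal cell_subset_closed_cell open_cell)
  show "interior (closed_cell n) \<subseteq> cell n"
  proof
    fix p assume p: "p \<in> interior (closed_cell n)"
    have move: "\<exists>r>0. p + r *\<^sub>R d \<in> closed_cell n" for d
    proof -
      have "((\<lambda>r. p + r *\<^sub>R d) \<longlongrightarrow> p) (at_right 0)" by (auto intro!: tendsto_eq_intros)
      then have "\<forall>\<^sub>F r in at_right 0. p + r *\<^sub>R d \<in> interior (closed_cell n)"
        using p by (intro topological_tendstoD) auto
      then have "\<forall>\<^sub>F r in at_right 0. 0 < r \<and> p + r *\<^sub>R d \<in> interior (closed_cell n)"
        using eventually_at_right_less by (rule eventually_conj[rotated])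
      then show ?thesis
        using eventually_happens' trivial_limit_at_right_real interior_subset by blast
    qed
    have pos: "0 < lin l (1, sqrt 2)" if "l \<in> A" for l
      using weight_pos[OF that] by (simp add: weight_def lin_def)
    show "p \<in> cell n" unfolding cell_def
    proof (intro CollectI ballI)
      fix l assume l: "l \<in> A"
      obtain r where r: "0 < r" "p + r *\<^sub>R (1, sqrt 2) \<in> closed_cell n" using move by blast
      then have "form l (p + r *\<^sub>R (1, sqrt 2)) \<le> of_int (n l) + 1"
        using l unfolding closed_cell_def by blast
      then have up: "form l p < of_int (n l) + 1"
        unfolding form_add_scaleR using mult_pos_pos[OF r(1) pos[OF l]] by linarith
      obtain r where r: "0 < r" "p + r *\<^sub>R (- (1, sqrt 2)) \<in> closed_cell n" using move by blast
      then have "of_int (n l) \<le> form l (p + r *\<^sub>R (- (1, sqrt 2)))"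
        using l unfolding closed_cell_def by blast
      moreover have "lin l (- (1, sqrt 2)) = - lin l (1, sqrt 2)" by (simp add: lin_def)
      ultimately have "of_int (n l) < form l p"
        unfolding form_add_scaleR using mult_pos_pos[OF r(1) pos[OF l]] by simp
      with up show "of_int (n l) < form l p \<and> form l p < of_int (n l) + 1" by blast
    qed
  qed
qed

lemma closure_cell:
  assumes "cell n \<noteq> {}" shows "closure (cell n) = closed_cell n"
proof -
  have "closure (interior (closed_cell n)) = closure (closed_cell n)"
    by (intro convex_closure_interior convex_closed_cell) (simp add: interior_closed_cell assms)
  then show ?thesis
    using closure_closed[OF polyhedron_imp_closed[OF polyhedron_closed_cell, of n]]
    by (simp add: interior_closed_cell)
qed

subsection \<open>Corners of a cell\<close>

text \<open>\<open>apex 1 n\<close> is the lowest and \<open>apex (- 1) n\<close> the highest corner of the cell \<open>n\<close>.\<close>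
definition apex :: "real \<Rightarrow> ((complex \<times> complex) set \<Rightarrow> int) \<Rightarrow> real \<times> real \<Rightarrow> bool" where
  "apex e n v \<longleftrightarrow> v \<in> closed_cell n \<and> (\<exists>i\<in>A. \<exists>j\<in>A.
     form i v = of_int (n i) \<and> form j v = of_int (n j) + 1 \<and> e * slope i < e * slope j)"

text \<open>A displacement from \<open>v\<close> into the cell stays to the right of
  \<open>i\<close> and to the left of \<open>j\<close>, so
  \<open>slope i * s <= t <= slope j * s\<close>. This wedge opens only towards growing
  \<open>e * height\<close>, and \<open>s = 0\<close> leaves just its tip.\<close>

lemma apex_strict_min:
  assumes v: "apex e n v" and p: "p \<in> closed_cell n" "p \<noteq> v"
  shows "e * height v < e * height p"
proof -
  obtain i j where ij: "i \<in> A" "j \<in> A" "form i v = of_int (n i)" "form j v = of_int (n j) + 1"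
    "e * slope i < e * slope j"
    using v by (auto simp: apex_def)
  define s t where "s = height (p - v)" and "t = fst (p - v)"
  have "0 \<le> lin i (p - v)" "lin j (p - v) \<le> 0"
    using p(1) ij(1-4) form_diff[of i p v] form_diff[of j p v] by (auto simp: closed_cell_def)
  then have t: "slope i * s \<le> t" "t \<le> slope j * s"
    using ij(1,2) weight_pos[of i] weight_pos[of j]
    by (auto simp: lin_eq_slope s_def t_def zero_le_mult_iff mult_le_0_iff)
  have "s \<noteq> 0"
  proof
    assume "s = 0"
    with t have "t = 0" by simp
    with \<open>s = 0\<close> have "p - v = 0" by (simp add: s_def t_def height_def prod_eq_iff)
    with p(2) show False by simp
  qed
  moreover have "0 \<le> e * s"
  proof (rule ccontr)
    assume neg: "\<not> 0 \<le> e * s"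
    have "(e * slope j - e * slope i) * (e * s) = e\<^sup>2 * (slope j * s - slope i * s)"
      by (simp add: power2_eq_square algebra_simps)
    also have "\<dots> \<ge> 0" using t by (intro mult_nonneg_nonneg) auto
    finally show False using neg ij(5) by (simp add: zero_le_mult_iff)
  qed
  moreover have "e \<noteq> 0" using ij(5) by auto
  ultimately have "0 < e * s" by (simp add: less_le)
  then show ?thesis by (simp add: s_def height_diff algebra_simps)
qed

lemma apex_unique: "apex e n v \<Longrightarrow> apex e n v' \<Longrightarrow> v = v'"
  using apex_strict_min[of e n v v'] apex_strict_min[of e n v' v] by (force simp: apex_def)

lemma cell_not_on_line:
  assumes "p \<in> cell n" "l \<in> A" shows "form l p \<notin> \<int>"
  using assms by (intro between_consecutive_ints_not_Ints[of "n l"]) (auto simp: cell_def)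

text \<open>At a point of least height, a closed cell bounded by lines on one side only could be left
  downwards in a direction close to \<open>(1, sqrt 2)\<close> or to its opposite.\<close>
lemma apex_exists:
  assumes ne: "cell n \<noteq> {}" and e: "e = 1 \<or> e = - 1"
  shows "\<exists>v. apex e n v"
proof -
  have ee: "e * e = 1" using e by auto
  have "closed_cell n \<noteq> {}" using ne cell_subset_closed_cell by blast
  moreover have "continuous_on (closed_cell n) (\<lambda>p. e * height p)"
    unfolding height_def by (intro continuous_intros)
  ultimately obtain v where v: "v \<in> closed_cell n" "\<And>p. p \<in> closed_cell n \<Longrightarrow> e * height v \<le> e * height p"
    using continuous_attains_inf[OF compact_closed_cell] by metis
  define M where "M = (\<Sum>l\<in>A. \<bar>slope l\<bar>)"
  have M: "\<bar>slope l\<bar> \<le> M" if "l \<in> A" for l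
    unfolding M_def using finite_A that by (intro member_le_sum) auto
  \<comment> \<open>Every \<open>d \<tau>\<close> lowers \<open>e * height\<close> by 1. Since all
    \<open>e * slope l\<close> lie between \<open>- M\<close> and \<open>M\<close>, the choice
    \<open>\<tau> = - M\<close> lets no form increase and \<open>\<tau> = M\<close> lets none
    decrease.\<close>
  define d where "d \<tau> = (\<tau>, - e + sqrt 2 * \<tau>)" for \<tau>
  have hd: "height (d \<tau>) = - e" for \<tau> by (simp add: d_def height_def)
  have lin_d: "lin l (d \<tau>) = weight l * (\<tau> + e * slope l)" if "l \<in> A" for l \<tau>
    using that by (simp add: lin_eq_slope hd) (simp add: d_def algebra_simps)
  have e_slope: "\<bar>e * slope l\<bar> \<le> M" if "l \<in> A" for l using M[OF that] e by (auto simp: abs_mult)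
  have stuck: False if "\<forall>\<^sub>F r in at_right 0. v + r *\<^sub>R d \<tau> \<in> closed_cell n" for \<tau>
  proof -
    have "\<forall>\<^sub>F r in at_right 0. 0 < r \<and> v + r *\<^sub>R d \<tau> \<in> closed_cell n"
      using eventually_at_right_less that by (rule eventually_conj)
    then obtain r where "0 < r" "v + r *\<^sub>R d \<tau> \<in> closed_cell n"
      using eventually_happens' trivial_limit_at_right_real by blast
    then have "e * height v \<le> e * height v + r * (- (e * e))"
      using v(2) by (fastforce simp: height_add_scaleR hd algebra_simps)
    with \<open>0 < r\<close> ee show False by simp
  qed
  have "\<exists>i\<in>A. form i v = of_int (n i)"
  proof (rule ccontr)
    assume no: "\<not> (\<exists>i\<in>A. form i v = of_int (n i))"
    have "\<forall>\<^sub>F r in at_right 0. v + r *\<^sub>R d (- M) \<in> closed_cell n"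
    proof (rule closed_cell_direction[OF v(1)])
      fix l assume l: "l \<in> A"
      show "lin l (d (- M)) \<le> 0"
        using weight_pos[OF l] e_slope[OF l] by (simp add: lin_d l mult_le_0_iff)
    qed (use no in auto)
    then show False by (rule stuck)
  qed
  moreover have "\<exists>j\<in>A. form j v = of_int (n j) + 1"
  proof (rule ccontr)
    assume no: "\<not> (\<exists>j\<in>A. form j v = of_int (n j) + 1)"
    have "\<forall>\<^sub>F r in at_right 0. v + r *\<^sub>R d M \<in> closed_cell n"
    proof (rule closed_cell_direction[OF v(1)])
      fix l assume l: "l \<in> A"
      show "0 \<le> lin l (d M)"
        using weight_pos[OF l] e_slope[OF l] by (simp add: lin_d l zero_le_mult_iff)
    qed (use no in auto)
    then show False by (rule stuck)
  qed
  ultimately obtain i j where ij: "i \<in> A" "form i v = of_int (n i)" "j \<in> A" "form j v = of_int (n j) + 1"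
    by blast
  have "e * slope i < e * slope j"
  proof (rule ccontr)
    assume not_less: "\<not> e * slope i < e * slope j"
    have "slope i \<noteq> slope j"
    proof
      assume "slope i = slope j"
      then have "i = j" using slope_inj[of i j v] ij by simp
      with ij show False by simp
    qed
    then have "e * slope i \<noteq> e * slope j" using e by auto
    with not_less have "e * slope j < e * slope i" by linarith
    then have "(- e) * slope i < (- e) * slope j" by simp
    \<comment> \<open>If the wedge opened the other way, the minimum point \<open>v\<close> would
      also be a strict maximum of \<open>e * height\<close>; any point of the open cell refutes
      this.\<close>
    then have top: "apex (- e) n v" using ij v(1) unfolding apex_def by blast
    obtain p where p: "p \<in> cell n" using ne by blast
    then have "p \<noteq> v" using cell_not_on_line[OF p ij(1)] ij(2) by auto
    moreover have "p \<in> closed_cell n" using p cell_subset_closed_cell by blast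
    ultimately show False using apex_strict_min[OF top, of p] v(2)[of p] by simp
  qed
  then show ?thesis using ij v(1) unfolding apex_def by blast
qed

section \<open>Corners and side corners as extreme points\<close>

text \<open>The form of a line through \<open>q\<close> attains a bound at \<open>q\<close>, so a
  segment of the cell with \<open>q\<close> inside must run along that line; two such lines have
  different directions. With at most one line through \<open>q\<close>, one can move both ways along
  it.\<close>

lemma extreme_point_closed_cell_iff:
  "q extreme_point_of closed_cell n \<longleftrightarrow>
     q \<in> closed_cell n \<and> (\<exists>i\<in>A. \<exists>j\<in>A. i \<noteq> j \<and> form i q \<in> \<int> \<and> form j q \<in> \<int>)"
    (is "?L \<longleftrightarrow> ?R")
proof
  assume R: ?R
  then obtain i j where ij: "i \<in> A" "j \<in> A" "i \<noteq> j" "form i q \<in> \<int>" "form j q \<in> \<int>" by blast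
  have par: "lin l (x - y) = 0"
    if l: "l \<in> A" "form l q \<in> \<int>" and xy: "x \<in> closed_cell n" "y \<in> closed_cell n"
      and u: "0 < u" "u < 1" "q = (1 - u) *\<^sub>R x + u *\<^sub>R y" for l x y u
  proof -
    have b: "of_int (n l) \<le> form l z" "form l z \<le> of_int (n l) + 1" if "z \<in> closed_cell n" for z
      using that l(1) by (auto simp: closed_cell_def)
    have q: "q \<in> closed_cell n" using R by blast
    have "form l q = of_int (n l) \<or> form l q = of_int (n l) + 1"
      using between_consecutive_ints_not_Ints[of "n l" "form l q"] l(2) b[OF q] by force
    moreover have "(1 - u) * (form l x - form l q) + u * (form l y - form l q) = 0"
      by (simp add: u(3) form_def lin_def algebra_simps)
    moreover have "0 < 1 - u" using u(2) by simp
    ultimately have "form l x - form l q = 0 \<and> form l y - form l q = 0"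
    proof (elim disjE, goal_cases)
      case 1
      then have "0 \<le> form l x - form l q" "0 \<le> form l y - form l q" using b[OF xy(1)] b[OF xy(2)] by auto
      with 1 u(1) have "(1 - u) * (form l x - form l q) = 0 \<and> u * (form l y - form l q) = 0"
        by (intro add_nonneg_eq_0_iff[THEN iffD1] mult_nonneg_nonneg) auto
      with 1 u(1) show ?case by auto
    next
      case 2
      then have "form l x - form l q \<le> 0" "form l y - form l q \<le> 0" using b[OF xy(1)] b[OF xy(2)] by auto
      with 2 u(1) have "(1 - u) * (form l x - form l q) = 0 \<and> u * (form l y - form l q) = 0"
        by (intro add_nonpos_eq_0_iff[THEN iffD1] mult_nonneg_nonpos) auto
      with 2 u(1) show ?case by auto
    qed
    then show ?thesis using form_diff[of l x y] by simp
  qed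
  show ?L unfolding extreme_point_of_def
  proof (intro conjI ballI notI)
    show "q \<in> closed_cell n" using R by blast
    fix x y assume xy: "x \<in> closed_cell n" "y \<in> closed_cell n" "q \<in> open_segment x y"
    then obtain u where u: "x \<noteq> y" "0 < u" "u < 1" "q = (1 - u) *\<^sub>R x + u *\<^sub>R y"
      by (auto simp: in_segment)
    have "slope i \<noteq> slope j" using ij slope_inj by blast
    then have "x - y = 0"
      using ij par[OF _ _ xy(1,2) u(2-4)] lin_eq_0_imp[of i j "x - y"] by blast
    with u(1) show False by simp
  qed
next
  assume L: ?L
  then have q: "q \<in> closed_cell n" by (simp add: extreme_point_of_def)
  show ?R
  proof (rule ccontr)
    assume "\<not> ?R"
    with q have no: "i = j" if "i \<in> A" "j \<in> A" "form i q \<in> \<int>" "form j q \<in> \<int>" for i j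
      using that by blast
    have "\<exists>j\<in>A. \<forall>l\<in>A. form l q \<in> \<int> \<longrightarrow> l = j"
    proof (cases "\<exists>j\<in>A. form j q \<in> \<int>")
      case True
      then show ?thesis using no by metis
    next
      case False
      \<comment> \<open>With no line through \<open>q\<close>, any line of \<open>A\<close> serves
        as \<open>j\<close>; \<open>essential\<close> provides one.\<close>
      then show ?thesis using essential by metis
    qed
    then obtain j where j: "j \<in> A" "\<And>l. l \<in> A \<Longrightarrow> form l q \<in> \<int> \<Longrightarrow> l = j" by metis
    define d :: "real \<times> real" where "d = (- of_int (b j), of_int (a j))"
    have "d \<noteq> 0" using coprime_ab[OF j(1)] by (auto simp: d_def zero_prod_def)
    have lin0: "lin l d = 0" "lin l (- d) = 0" if "l \<in> A" "form l q = of_int k" for l and k :: int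
    proof -
      have "l = j" using that j(2) by simp
      then show "lin l d = 0" "lin l (- d) = 0" by (simp_all add: lin_def d_def)
    qed
    have act: "form l q = of_int (n l) + 1 \<Longrightarrow> form l q = of_int (n l + 1)" for l by simp
    have "\<forall>\<^sub>F r in at_right 0. q + r *\<^sub>R d \<in> closed_cell n"
      "\<forall>\<^sub>F r in at_right 0. q + r *\<^sub>R (- d) \<in> closed_cell n"
      by (rule closed_cell_direction[OF q]; use lin0 act in \<open>metis order_refl\<close>)+
    then have "\<forall>\<^sub>F r in at_right 0. 0 < r \<and> q + r *\<^sub>R d \<in> closed_cell n \<and> q + r *\<^sub>R (- d) \<in> closed_cell n"
      by (intro eventually_conj eventually_at_right_less)
    then obtain r where r: "0 < r" "q + r *\<^sub>R d \<in> closed_cell n" "q + r *\<^sub>R (- d) \<in> closed_cell n"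
      using eventually_happens' trivial_limit_at_right_real by blast
    have "q + r *\<^sub>R d \<noteq> q + r *\<^sub>R (- d)"
    proof
      assume "q + r *\<^sub>R d = q + r *\<^sub>R (- d)"
      then have "r *\<^sub>R d + r *\<^sub>R d = 0" by (simp add: algebra_simps eq_neg_iff_add_eq_0)
      then have "(r + r) *\<^sub>R d = 0" by (simp only: scaleR_add_left)
      with r(1) \<open>d \<noteq> 0\<close> show False by simp
    qed
    moreover have "q = (1 - 1 / 2) *\<^sub>R (q + r *\<^sub>R d) + (1 / 2) *\<^sub>R (q + r *\<^sub>R (- d))"
      by (simp add: prod_eq_iff field_simps)
    ultimately have "q \<in> open_segment (q + r *\<^sub>R d) (q + r *\<^sub>R (- d))"
      unfolding in_segment by (intro conjI exI[of _ "1 / 2 :: real"]) auto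
    with r L show False unfolding extreme_point_of_def by blast
  qed
qed

text \<open>The cell entered from \<open>v\<close> in direction \<open>(1, sqrt 2)\<close>, respectively \<open>- (1, sqrt 2)\<close>.\<close>
definition side_cell :: "bool \<Rightarrow> real \<times> real \<Rightarrow> (complex \<times> complex) set \<Rightarrow> int" where
  "side_cell t v l = (if t then \<lfloor>form l v\<rfloor> else \<lceil>form l v\<rceil> - 1)"

lemma side_cell_simps:
  "side_cell True v l = \<lfloor>form l v\<rfloor>" "side_cell False v l = \<lceil>form l v\<rceil> - 1"
  by (simp_all add: side_cell_def)

lemma side_cell_bounds:
  "of_int (side_cell True v l) \<le> form l v" "form l v < of_int (side_cell True v l) + 1"
  "of_int (side_cell False v l) < form l v" "form l v \<le> of_int (side_cell False v l) + 1"
  unfolding side_cell_simps using floor_correct[of "form l v"] ceiling_correct[of "form l v"]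
  by simp_all

definition on_two_lines :: "real \<times> real \<Rightarrow> bool" where
  "on_two_lines v \<longleftrightarrow> (\<exists>i\<in>A. \<exists>j\<in>A. i \<noteq> j \<and> form i v \<in> \<int> \<and> form j v \<in> \<int>)"

lemma apex_on_two_lines: "apex e n v \<Longrightarrow> on_two_lines v"
proof -
  assume "apex e n v"
  then obtain i j where ij: "i \<in> A" "j \<in> A" "form i v = of_int (n i)" "form j v = of_int (n j) + 1"
    by (auto simp: apex_def)
  then have "i \<noteq> j" by auto
  moreover have "form i v \<in> \<int>" "form j v \<in> \<int>" using ij by auto
  ultimately show ?thesis unfolding on_two_lines_def using ij by blast
qed

lemma side_cell_nonempty: "cell (side_cell t v) \<noteq> {}"
proof (cases t)
  case True
  have "0 < lin l (1, sqrt 2)" if "l \<in> A" for l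
    using weight_pos[OF that] by (simp add: weight_def lin_def)
  then show ?thesis
    using side_cell_bounds(1,2) True
    by (intro cell_direction[of _ v "(1, sqrt 2)"]) (auto simp: less_le)
next
  case False
  have "lin l (- 1, - sqrt 2) < 0" if "l \<in> A" for l
    using weight_pos[OF that] by (simp add: weight_def lin_def)
  then show ?thesis
    using side_cell_bounds(3,4) False
    by (intro cell_direction[of _ v "(- 1, - sqrt 2)"]) (auto simp: less_le)
qed

lemma in_closed_side_cell:
  assumes "\<And>l. l \<in> A \<Longrightarrow> n l = side_cell t v l"
  shows "v \<in> closed_cell n"
  unfolding closed_cell_def
proof (intro CollectI ballI)
  fix l assume "l \<in> A"
  then show "of_int (n l) \<le> form l v \<and> form l v \<le> of_int (n l) + 1"
    by (cases t) (simp_all add: assms side_cell_bounds less_imp_le)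
qed

text \<open>The lines through \<open>v\<close> bound a side cell all from the left or all from the
  right, whereas an apex needs one of each kind.\<close>

lemma not_apex_side_cell:
  assumes "\<And>l. l \<in> A \<Longrightarrow> n l = side_cell t v l"
  shows "\<not> apex e n v"
proof
  assume "apex e n v"
  then obtain i j where "i \<in> A" "j \<in> A" "form i v = of_int (n i)" "form j v = of_int (n j) + 1"
    by (auto simp: apex_def)
  then show False
    using assms[of i] assms[of j] side_cell_bounds(2)[of j v] side_cell_bounds(3)[of v i]
    by (cases t) simp_all
qed

lemma side_cell_unique:
  assumes "on_two_lines v" "\<And>l. l \<in> A \<Longrightarrow> side_cell t v l = side_cell t' v l"
  shows "t = t'"
proof -
  obtain i where i: "i \<in> A" "form i v \<in> \<int>" using assms(1) by (auto simp: on_two_lines_def)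
  then obtain k :: int where "form i v = of_int k" by (auto elim: Ints_cases)
  then show ?thesis using assms(2)[OF i(1)] by (auto simp: side_cell_def split: if_splits)
qed

text \<open>Distinguish whether bounds are attained at \<open>q\<close> on both sides, never on the
  right, or never on the left. In the first case the two lines differ in slope by
  \<open>slope_inj\<close>, and the wedge between them opens up or down; in the others rounding the
  forms at \<open>q\<close> gives the code.\<close>

lemma corner_cases:
  assumes q: "q \<in> closed_cell n"
  obtains "apex 1 n q" | "apex (- 1) n q" | t where "\<And>l. l \<in> A \<Longrightarrow> n l = side_cell t q l"
proof -
  have b: "of_int (n l) \<le> form l q" "form l q \<le> of_int (n l) + 1" if "l \<in> A" for l
    using that q by (auto simp: closed_cell_def)
  consider "\<exists>i\<in>A. \<exists>j\<in>A. form i q = of_int (n i) \<and> form j q = of_int (n j) + 1"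
    | "\<forall>j\<in>A. form j q \<noteq> of_int (n j) + 1" | "\<forall>i\<in>A. form i q \<noteq> of_int (n i)" by blast
  then show ?thesis
  proof cases
    case 1
    then obtain i j where ij: "i \<in> A" "j \<in> A" "form i q = of_int (n i)" "form j q = of_int (n j) + 1"
      by blast
    have "slope i \<noteq> slope j"
    proof
      assume "slope i = slope j"
      then have "i = j" using slope_inj[of i j q] ij by simp
      with ij show False by simp
    qed
    then have "1 * slope i < 1 * slope j \<or> (- 1) * slope i < (- 1) * slope j" by auto
    then have "apex 1 n q \<or> apex (- 1) n q" unfolding apex_def using ij q by blast
    then show ?thesis using that by blast
  next
    case 2
    have "n l = side_cell True q l" if "l \<in> A" for l
    proof -
      have "form l q < of_int (n l) + 1" using 2 b[OF that] that by force
      then have "\<lfloor>form l q\<rfloor> = n l" using b[OF that] by (intro floor_unique) auto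
      then show ?thesis by (simp add: side_cell_def)
    qed
    then show ?thesis using that by blast
  next
    case 3
    have "n l = side_cell False q l" if "l \<in> A" for l
    proof -
      have "of_int (n l) < form l q" using 3 b[OF that] that by force
      then have "\<lceil>form l q\<rceil> = n l + 1" using b[OF that] by (intro ceiling_unique) auto
      then show ?thesis by (simp add: side_cell_def)
    qed
    then show ?thesis using that by blast
  qed
qed

definition corners :: "((complex \<times> complex) set \<Rightarrow> int) \<Rightarrow> (real \<times> real) set" where
  "corners n = {q. q extreme_point_of closed_cell n}"

definition side_corners :: "((complex \<times> complex) set \<Rightarrow> int) \<Rightarrow> (real \<times> real) set" where
  "side_corners n = {q. on_two_lines q \<and> (\<exists>t. \<forall>l\<in>A. n l = side_cell t q l)}"

lemma corners_eq: "corners n = {q \<in> closed_cell n. on_two_lines q}"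
  by (auto simp: corners_def extreme_point_closed_cell_iff on_two_lines_def)

lemma finite_corners: "finite (corners n)"
  unfolding corners_def by (rule finite_polyhedron_extreme_points[OF polyhedron_closed_cell])

lemma closed_cell_eq_hull: "closed_cell n = convex hull (corners n)"
  unfolding corners_def
  by (rule Krein_Milman_Minkowski[OF compact_closed_cell convex_closed_cell])

lemma corners_convex_independent:
  assumes "q \<in> corners n" shows "q \<notin> convex hull (corners n - {q})"
proof
  assume "q \<in> convex hull (corners n - {q})"
  then have "convex hull (corners n) = convex hull (corners n - {q})"
    using assms by (metis hull_insert hull_redundant insert_Diff)
  then have "q extreme_point_of convex hull (corners n - {q})"
    using assms by (metis closed_cell_eq_hull corners_def mem_Collect_eq)
  then show False using extreme_point_of_convex_hull by blast
qed

lemma card_corners_ge_3: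
  assumes "cell n \<noteq> {}" shows "3 \<le> card (corners n)"
proof (rule ccontr)
  assume "\<not> 3 \<le> card (corners n)"
  then have "interior (convex hull (corners n)) = {}"
    by (intro empty_interior_convex_hull finite_corners) simp
  with assms show False by (simp flip: closed_cell_eq_hull add: interior_closed_cell)
qed

text \<open>The 2 counts the lowest and the highest corner, each of which exists and is unique; they
  differ because a point of the open cell lies strictly between them in height.\<close>

lemma card_corners:
  assumes ne: "cell n \<noteq> {}"
  shows "finite (side_corners n)" "card (corners n) = card (side_corners n) + 2"
proof -
  obtain v w where v: "apex 1 n v" and w: "apex (- 1) n w"
    using apex_exists[OF ne] by blast
  have vw: "v \<noteq> w"
  proof
    assume "v = w"
    obtain p where p: "p \<in> cell n" using ne by blast
    then have pc: "p \<in> closed_cell n" using cell_subset_closed_cell by blast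
    obtain i where "i \<in> A" "form i v \<in> \<int>" using apex_on_two_lines[OF v] by (auto simp: on_two_lines_def)
    then have "p \<noteq> v" using cell_not_on_line[OF p] by blast
    then show False
      using apex_strict_min[OF v pc] apex_strict_min[OF w pc] \<open>v = w\<close> by simp
  qed
  have "corners n = side_corners n \<union> {v, w}"
  proof (intro equalityI subsetI)
    fix q assume "q \<in> corners n"
    then have q: "q \<in> closed_cell n" "on_two_lines q" by (auto simp: corners_eq)
    from q(1) show "q \<in> side_corners n \<union> {v, w}"
    proof (cases rule: corner_cases)
      case 1 then show ?thesis using apex_unique[OF v] by blast
    next
      case 2 then show ?thesis using apex_unique[OF w] by blast
    next
      case (3 t) then show ?thesis using q(2) by (auto simp: side_corners_def)
    qed
  next
    fix q assume "q \<in> side_corners n \<union> {v, w}"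
    then consider "apex 1 n q" | "apex (- 1) n q" | "q \<in> side_corners n" using v w by blast
    then have "q \<in> closed_cell n \<and> on_two_lines q"
      using apex_on_two_lines in_closed_side_cell unfolding apex_def side_corners_def
      by cases blast+
    then show "q \<in> corners n" by (simp add: corners_eq)
  qed
  moreover have "v \<notin> side_corners n" "w \<notin> side_corners n"
    using not_apex_side_cell v w unfolding side_corners_def by blast+
  moreover from calculation show "finite (side_corners n)" using finite_corners by (metis finite_Un)
  ultimately show "card (corners n) = card (side_corners n) + 2" using vw by (simp add: Un_commute)
qed

subsection \<open>Chambers as images of cells\<close>

text \<open>The action of the integer translation by \<open>(i, j)\<close> on codes.\<close>

definition shift :: "((complex \<times> complex) set \<Rightarrow> int) \<Rightarrow> int \<Rightarrow> int \<Rightarrow> (complex \<times> complex) set \<Rightarrow> int" where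
  "shift n i j l = n l + (a l * i + b l * j)"

definition chamber :: "((complex \<times> complex) set \<Rightarrow> int) \<Rightarrow> (complex \<times> complex) set" where
  "chamber n = torus_map ` cell n"

lemma cell_shift: "p + (of_int i, of_int j) \<in> cell (shift n i j) \<longleftrightarrow> p \<in> cell n"
proof -
  have "of_int (shift n i j l) < form l (p + (of_int i, of_int j))
      \<and> form l (p + (of_int i, of_int j)) < of_int (shift n i j l) + 1
    \<longleftrightarrow> of_int (n l) < form l p \<and> form l p < of_int (n l) + 1" for l
    unfolding form_add_int shift_def of_int_add by linarith
  then show ?thesis by (simp add: cell_def)
qed

lemma chamber_cong: "(\<And>l. l \<in> A \<Longrightarrow> n l = n' l) \<Longrightarrow> chamber n = chamber n'"
  unfolding chamber_def using cell_cong by metis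

lemma cell_code_eq:
  assumes "p \<in> cell n" "l \<in> A" shows "n l = \<lfloor>form l p\<rfloor>"
  using assms by (intro floor_unique[symmetric]) (auto simp: cell_def)

lemma chamber_shift: "chamber (shift n i j) = chamber n"
proof -
  have "torus_map p \<in> torus_map ` cell (shift n i j)" if "p \<in> cell n" for p
    using cell_shift[of p i j n] that by (metis imageI torus_map_add_int)
  moreover have "torus_map p \<in> torus_map ` cell n" if "p \<in> cell (shift n i j)" for p
  proof -
    have eq: "p + (of_int (- i), of_int (- j)) + (of_int i, of_int j) = p" by (simp add: prod_eq_iff)
    have "p + (of_int (- i), of_int (- j)) \<in> cell n"
      using cell_shift[of "p + (of_int (- i), of_int (- j))" i j n] that unfolding eq by blast
    then show ?thesis by (metis imageI torus_map_add_int)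
  qed
  ultimately show ?thesis unfolding chamber_def by auto
qed

text \<open>Two lifts of a common point differ by an integer vector, and a code can be read off from
  any point of its cell by taking floors.\<close>

lemma chamber_meet:
  assumes "x \<in> chamber n" "x \<in> chamber n'"
  obtains i j where "\<And>l. l \<in> A \<Longrightarrow> n' l = shift n i j l"
proof -
  obtain p p' where p: "p \<in> cell n" "p' \<in> cell n'" "torus_map p = torus_map p'"
    using assms by (auto simp: chamber_def)
  then obtain i j where ij: "p' = p + (of_int i, of_int j)" by (auto simp: torus_map_eq_iff)
  then have "p' \<in> cell (shift n i j)" using p(1) cell_shift by simp
  then have "\<And>l. l \<in> A \<Longrightarrow> n' l = shift n i j l" using p(2) cell_code_eq by metis
  then show ?thesis by (rule that)
qed

lemma chamber_eqE:
  assumes "chamber n = chamber n'" "cell n \<noteq> {}"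
  obtains i j where "\<And>l. l \<in> A \<Longrightarrow> n' l = shift n i j l"
proof -
  obtain x where "x \<in> chamber n" using assms(2) unfolding chamber_def by blast
  with assms(1) show ?thesis using chamber_meet[of x n n'] that by metis
qed

text \<open>A translation that fixes a code is annihilated by two non-parallel linear forms. This is
  how essentiality makes the covering map injective on cells.\<close>

lemma shift_trivial:
  assumes "\<And>l. l \<in> A \<Longrightarrow> shift n i j l = n l"
  shows "i = 0 \<and> j = 0"
proof -
  obtain l l' where l: "l \<in> A" "l' \<in> A" "slope l \<noteq> slope l'" using exists_slopes_neq by blast
  have "lin k (of_int i, of_int j) = 0" if "k \<in> A" for k
  proof -
    have "a k * i + b k * j = 0" using assms[OF that] by (simp add: shift_def)
    then have "real_of_int (a k * i + b k * j) = 0" by (simp only: of_int_0)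
    then show ?thesis by (simp add: lin_def)
  qed
  then have "(of_int i, of_int j) = (0 :: real \<times> real)" using lin_eq_0_imp l by blast
  then show ?thesis by (simp add: zero_prod_def)
qed

lemma inj_on_cell: "inj_on torus_map (cell n)"
proof (rule inj_onI)
  fix p q assume pq: "p \<in> cell n" "q \<in> cell n" "torus_map p = torus_map q"
  then obtain i j where ij: "q = p + (of_int i, of_int j)" by (auto simp: torus_map_eq_iff)
  then have "q \<in> cell (shift n i j)" using pq(1) cell_shift by simp
  then have "\<And>l. l \<in> A \<Longrightarrow> shift n i j l = n l" using pq(2) cell_code_eq by metis
  then have "i = 0 \<and> j = 0" by (rule shift_trivial)
  with ij show "p = q" by (simp add: prod_eq_iff)
qed

lemma torus_diff_lines_eq: "torus - \<Union>A = \<Union>{chamber n |n. cell n \<noteq> {}}"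
proof (intro equalityI subsetI)
  fix x assume x: "x \<in> torus - \<Union>A"
  then obtain p where p: "x = torus_map p" by (auto simp: torus_def)
  have "p \<in> cell (\<lambda>l. \<lfloor>form l p\<rfloor>)"
    unfolding cell_def
  proof (intro CollectI ballI)
    fix l assume "l \<in> A"
    then have "form l p \<notin> \<int>" using x p torus_map_in_line_iff by blast
    then have "of_int \<lfloor>form l p\<rfloor> \<noteq> form l p" by (metis Ints_of_int)
    then show "of_int \<lfloor>form l p\<rfloor> < form l p \<and> form l p < of_int \<lfloor>form l p\<rfloor> + 1"
      using floor_correct[of "form l p"] by linarith
  qed
  then show "x \<in> \<Union>{chamber n |n. cell n \<noteq> {}}" using p unfolding chamber_def by blast
next
  fix x assume "x \<in> \<Union>{chamber n |n. cell n \<noteq> {}}"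
  then obtain p n where p: "p \<in> cell n" "x = torus_map p" by (auto simp: chamber_def)
  then show "x \<in> torus - \<Union>A"
    using cell_not_on_line torus_map_in_line_iff by (auto simp: torus_def)
qed

lemma chambers_eq: "chambers A = {chamber n |n. cell n \<noteq> {}}"
  unfolding chambers_def
proof (rule components_eqI_openin)
  show "\<Union>{chamber n |n. cell n \<noteq> {}} = torus - \<Union>A" by (simp add: torus_diff_lines_eq)
  fix C assume "C \<in> {chamber n |n. cell n \<noteq> {}}"
  then obtain n where n: "C = chamber n" "cell n \<noteq> {}" by blast
  show "C \<noteq> {}" using n by (simp add: chamber_def)
  show "connected C" unfolding n chamber_def
    by (intro connected_continuous_image continuous_on_torus_map convex_connected convex_cell)
  have "openin (top_of_set torus) C" unfolding n chamber_def by (rule torus_map_open_map[OF open_cell])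
  moreover have "C \<subseteq> torus - \<Union>A" using n torus_diff_lines_eq by blast
  ultimately show "openin (top_of_set (torus - \<Union>A)) C" by (rule openin_subset_trans) auto
next
  fix C D assume "C \<in> {chamber n |n. cell n \<noteq> {}}" "D \<in> {chamber n |n. cell n \<noteq> {}}" "C \<inter> D \<noteq> {}"
  then obtain n n' x where n: "C = chamber n" "D = chamber n'" "x \<in> chamber n" "x \<in> chamber n'" by blast
  then obtain i j where "\<And>l. l \<in> A \<Longrightarrow> n' l = shift n i j l" using chamber_meet by metis
  then have "chamber n' = chamber (shift n i j)" by (rule chamber_cong)
  then show "C = D" using n by (simp add: chamber_shift)
qed

section \<open>Triangular chambers\<close>

lemma toric_3gon_chamberI:
  assumes "cell n \<noteq> {}" "card (corners n) = 3"
  shows "toric_kgon 3 (chamber n)"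
proof -
  have "is_kgon 3 (cell n)"
    unfolding is_kgon_def using assms(2) finite_corners corners_convex_independent
    by (intro exI[of _ "corners n"]) (simp flip: closed_cell_eq_hull add: interior_closed_cell)
  moreover have "openin (top_of_set (torus_map ` cell n)) (torus_map ` U)"
    if "openin (top_of_set (cell n)) U" for U
  proof (rule openin_subset_trans)
    have "open U" using that open_cell openin_open_eq by blast
    then show "openin (top_of_set torus) (torus_map ` U)" by (rule torus_map_open_map)
    show "torus_map ` U \<subseteq> torus_map ` cell n" using openin_imp_subset[OF that] by blast
    show "torus_map ` cell n \<subseteq> torus" by (auto simp: torus_def)
  qed
  then obtain g where "homeomorphism (cell n) (torus_map ` cell n) torus_map g"
    using homeomorphism_injective_open_map[OF continuous_on_torus_map refl inj_on_cell] by metis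
  then have "\<exists>g. homeomorphism (interior (cell n)) (torus_map ` interior (cell n)) torus_map g"
    using interior_open[OF open_cell, of n] by auto
  ultimately show ?thesis unfolding toric_kgon_def chamber_def by blast
qed

text \<open>The interior of the given triangle is connected and avoids all lifted lines, so it lies
  in a single cell. Both have image \<open>C\<close>, and injectivity on the cell turns this into
  equality; taking closures makes the triangle's vertices the corners of the cell.\<close>

lemma toric_3gon_chamberD:
  assumes C: "C \<in> chambers A" "toric_kgon 3 C"
  obtains n where "cell n \<noteq> {}" "C = chamber n" "card (corners n) = 3"
proof -
  obtain P where P: "finite P" "card P = 3" "\<And>q. q \<in> P \<Longrightarrow> q \<notin> convex hull (P - {q})"
    and img: "torus_map ` interior (convex hull P) = C"
    using C(2) unfolding toric_kgon_def is_kgon_def by blast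
  define T where "T = interior (convex hull P)"
  obtain n0 where n0: "C = chamber n0" "cell n0 \<noteq> {}" using C(1) unfolding chambers_eq by blast
  then have "T \<noteq> {}" using img by (auto simp: T_def chamber_def)
  then obtain p where p: "p \<in> T" by blast
  have convT: "convex T" unfolding T_def by (intro convex_interior convex_convex_hull)
  have avoid: "form l q \<notin> \<int>" if "q \<in> T" "l \<in> A" for q l
  proof -
    have "torus_map q \<in> torus - \<Union>A"
      unfolding torus_diff_lines_eq using that(1) n0 img by (auto simp: T_def)
    then show ?thesis using torus_map_in_line_iff that(2) by blast
  qed
  define n where "n l = \<lfloor>form l p\<rfloor>" for l
  have T_sub: "T \<subseteq> cell n"
  proof
    fix q assume q: "q \<in> T"
    have between: "\<exists>z\<in>T. form l z = x" if "x \<in> closed_segment (form l p) (form l q)" for x l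
    proof -
      have "connected (form l ` T)"
        using convT by (intro connected_continuous_image convex_connected)
          (auto simp: form_def lin_def intro!: continuous_intros)
      then have "closed_segment (form l p) (form l q) \<subseteq> form l ` T"
        using p q by (intro closed_segment_subset) (auto simp flip: is_interval_convex_1 simp: is_interval_connected_1)
      then show ?thesis using that by blast
    qed
    show "q \<in> cell n" unfolding cell_def
    proof (intro CollectI ballI conjI)
      fix l assume l: "l \<in> A"
      have fl: "of_int (n l) \<le> form l p" "form l p < of_int (n l) + 1"
        unfolding n_def using floor_correct by auto
      show "of_int (n l) < form l q"
      proof (rule ccontr)
        assume "\<not> of_int (n l) < form l q"
        then have "of_int (n l) \<in> closed_segment (form l p) (form l q)"
          using fl by (simp add: closed_segment_eq_real_ivl)
        then show False using between avoid[OF _ l] by (metis Ints_of_int)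
      qed
      show "form l q < of_int (n l) + 1"
      proof (rule ccontr)
        assume "\<not> form l q < of_int (n l) + 1"
        then have "of_int (n l + 1) \<in> closed_segment (form l p) (form l q)"
          using fl by (simp add: closed_segment_eq_real_ivl)
        then show False using between avoid[OF _ l] by (metis Ints_of_int)
      qed
    qed
  qed
  then have ne: "cell n \<noteq> {}" using p by blast
  have "torus_map p \<in> chamber n0" using p img n0 by (auto simp: T_def)
  moreover have "torus_map p \<in> chamber n" using p T_sub by (auto simp: chamber_def)
  ultimately obtain i j where "\<And>l. l \<in> A \<Longrightarrow> n l = shift n0 i j l" using chamber_meet by metis
  then have "chamber n = C" using chamber_cong chamber_shift n0 by metis
  then have "torus_map ` cell n = torus_map ` T" using img by (simp add: T_def chamber_def)
  then have "cell n = T" using inj_on_image_eq_iff[OF inj_on_cell] T_sub by blast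
  moreover have "closure T = convex hull P"
    unfolding T_def using \<open>T \<noteq> {}\<close> P(1)
    by (subst convex_closure_interior)
      (auto simp: T_def closure_closed compact_imp_closed finite_imp_compact_convex_hull)
  ultimately have "closed_cell n = convex hull P" using closure_cell[OF ne] by simp
  then have "corners n = P"
    using extreme_point_of_convex_hull_convex_independent[of P] P by (auto simp: corners_def finite_imp_compact)
  then show ?thesis using that ne \<open>chamber n = C\<close> P(2) by metis
qed

section \<open>Cells around a vertex and their integer translates\<close>

lemma side_cell_add_int:
  "side_cell t (v + (of_int i, of_int j)) l = shift (side_cell t v) i j l"
proof -
  have "\<lfloor>form l v + of_int k\<rfloor> = \<lfloor>form l v\<rfloor> + k" "\<lceil>form l v + of_int k\<rceil> = \<lceil>form l v\<rceil> + k" for k by simp_all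
  note * = this[of "a l * i + b l * j"]
  show ?thesis unfolding side_cell_def shift_def form_add_int * by simp
qed

text \<open>The cell having \<open>v\<close> as its lowest corner and there the line \<open>l\<close> as its left boundary.\<close>
definition fan_cell :: "real \<times> real \<Rightarrow> (complex \<times> complex) set \<Rightarrow> (complex \<times> complex) set \<Rightarrow> int" where
  "fan_cell v l k = (if form k v \<in> \<int> \<and> slope l < slope k then \<lfloor>form k v\<rfloor> - 1 else \<lfloor>form k v\<rfloor>)"

text \<open>The half of \<open>l\<close> above \<open>v\<close> has a sector on its right, bounded
  by a further line through \<open>v\<close>, exactly if some line through \<open>v\<close> leans
  further to the right.\<close>

definition up_edge :: "real \<times> real \<Rightarrow> (complex \<times> complex) set \<Rightarrow> bool" where
  "up_edge v l \<longleftrightarrow> l \<in> A \<and> form l v \<in> \<int> \<and> (\<exists>k\<in>A. form k v \<in> \<int> \<and> slope l < slope k)"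

lemma form_add_int_Ints: "form l (v + (of_int i, of_int j)) \<in> \<int> \<longleftrightarrow> form l v \<in> \<int>"
  unfolding form_add_int by (metis Ints_add Ints_diff Ints_of_int add_diff_cancel_right')

lemma fan_cell_add_int:
  "fan_cell (v + (of_int i, of_int j)) l k = shift (fan_cell v l) i j k"
proof -
  have "\<lfloor>form k v + of_int m\<rfloor> = \<lfloor>form k v\<rfloor> + m" for m by simp
  note * = this[of "a k * i + b k * j"]
  show ?thesis unfolding fan_cell_def shift_def form_add_int_Ints unfolding form_add_int * by simp
qed

lemma fan_cell_nonempty:
  assumes "up_edge v l" shows "cell (fan_cell v l) \<noteq> {}"
proof -
  define S where "S = {k \<in> A. form k v \<in> \<int> \<and> slope l < slope k}"
  have S: "finite (slope ` S)" "slope ` S \<noteq> {}"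
    using assms finite_A by (auto simp: S_def up_edge_def)
  define m where "m = Min (slope ` S)"
  have "m \<in> slope ` S" unfolding m_def using S by (rule Min_in)
  then have lm: "slope l < m" by (auto simp: S_def)
  have m: "m \<le> slope k" if "k \<in> S" for k unfolding m_def using S(1) that by (intro Min_le) auto
  \<comment> \<open>Strictly between \<open>slope l\<close> and the next larger slope at
    \<open>v\<close>, so that the direction of height 1 with this first coordinate points into the
    sector right of \<open>l\<close>.\<close>
  define \<tau> where "\<tau> = (slope l + m) / 2"
  have \<tau>: "slope l < \<tau>" "\<tau> < m" using lm by (simp_all add: \<tau>_def)
  have hd: "height (\<tau>, 1 + sqrt 2 * \<tau>) = 1" by (simp add: height_def)
  have lin: "lin k (\<tau>, 1 + sqrt 2 * \<tau>) = weight k * (\<tau> - slope k)" if "k \<in> A" for k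
    using that by (simp add: lin_eq_slope hd)
  show ?thesis
  proof (rule cell_direction)
    fix k assume k: "k \<in> A"
    have fl: "of_int \<lfloor>form k v\<rfloor> \<le> form k v" "form k v < of_int \<lfloor>form k v\<rfloor> + 1"
      using floor_correct by auto
    show "of_int (fan_cell v l k) < form k v
        \<or> of_int (fan_cell v l k) = form k v \<and> 0 < lin k (\<tau>, 1 + sqrt 2 * \<tau>)"
    proof (cases "k \<in> S")
      case True
      then have "fan_cell v l k = \<lfloor>form k v\<rfloor> - 1" by (simp add: fan_cell_def S_def)
      then have "of_int (fan_cell v l k) = real_of_int \<lfloor>form k v\<rfloor> - 1" by simp
      then show ?thesis using fl by linarith
    next
      case False
      then have eq: "fan_cell v l k = \<lfloor>form k v\<rfloor>" using k by (auto simp: fan_cell_def S_def)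
      have "0 < lin k (\<tau>, 1 + sqrt 2 * \<tau>)" if "of_int \<lfloor>form k v\<rfloor> = form k v"
      proof -
        have "form k v \<in> \<int>" using that by (metis Ints_of_int)
        then have "slope k \<le> slope l" using False k by (auto simp: S_def)
        then show ?thesis using \<tau> weight_pos[OF k] by (simp add: lin k)
      qed
      then show ?thesis unfolding eq using fl by linarith
    qed
    show "form k v < of_int (fan_cell v l k) + 1
        \<or> form k v = of_int (fan_cell v l k) + 1 \<and> lin k (\<tau>, 1 + sqrt 2 * \<tau>) < 0"
    proof (cases "k \<in> S")
      case True
      then have eq: "fan_cell v l k = \<lfloor>form k v\<rfloor> - 1" and int: "of_int \<lfloor>form k v\<rfloor> = form k v"
        by (auto simp: fan_cell_def S_def elim: Ints_cases)
      have "lin k (\<tau>, 1 + sqrt 2 * \<tau>) < 0"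
        using \<tau> m[OF True] weight_pos[OF k] by (simp add: lin k mult_less_0_iff)
      moreover have "of_int (fan_cell v l k) = real_of_int \<lfloor>form k v\<rfloor> - 1" using eq by simp
      ultimately show ?thesis using int by linarith
    next
      case False
      then have eq: "fan_cell v l k = \<lfloor>form k v\<rfloor>" using k by (auto simp: fan_cell_def S_def)
      then show ?thesis using fl by simp
    qed
  qed
qed

lemma fan_cell_apex:
  assumes l: "up_edge v l" shows "apex 1 (fan_cell v l) v"
  unfolding apex_def
proof (intro conjI)
  show "v \<in> closed_cell (fan_cell v l)"
    unfolding closed_cell_def
  proof (intro CollectI ballI)
    fix k
    show "of_int (fan_cell v l k) \<le> form k v \<and> form k v \<le> of_int (fan_cell v l k) + 1"
      using floor_correct[of "form k v"] by (auto simp: fan_cell_def elim: Ints_cases)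
  qed
  obtain k where k: "k \<in> A" "form k v \<in> \<int>" "slope l < slope k" using l by (auto simp: up_edge_def)
  have "form l v = of_int (fan_cell v l l)" "form k v = of_int (fan_cell v l k) + 1"
    using l k by (auto simp: fan_cell_def up_edge_def elim: Ints_cases)
  then show "\<exists>i\<in>A. \<exists>j\<in>A. form i v = of_int (fan_cell v l i)
      \<and> form j v = of_int (fan_cell v l j) + 1 \<and> 1 * slope i < 1 * slope j"
    using l k by (auto simp: up_edge_def)
qed

text \<open>At the lowest corner every left bound has smaller slope than every right bound, since
  otherwise \<open>v\<close> would be highest too. Hence the left bound \<open>l\<close> of largest
  slope separates them, and comparison with \<open>slope l\<close> recovers the code.\<close>

lemma apex_fan_cellE:
  assumes v: "apex 1 n v" and ne: "cell n \<noteq> {}"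
  obtains l where "up_edge v l" "\<And>k. k \<in> A \<Longrightarrow> n k = fan_cell v l k"
proof -
  define L where "L = {i \<in> A. form i v = of_int (n i)}"
  obtain i0 j0 where ij: "i0 \<in> A" "j0 \<in> A" "form i0 v = of_int (n i0)" "form j0 v = of_int (n j0) + 1"
    using v by (auto simp: apex_def)
  have "finite L" "L \<noteq> {}" using finite_A ij by (auto simp: L_def)
  then obtain l where l: "l \<in> L" "\<And>k. k \<in> L \<Longrightarrow> slope k \<le> slope l"
    using finite_obtains_maximum[of L slope] by metis
  have lA: "l \<in> A" "form l v = of_int (n l)" using l(1) by (auto simp: L_def)
  have lt: "slope i < slope j"
    if "i \<in> A" "j \<in> A" "form i v = of_int (n i)" "form j v = of_int (n j) + 1" for i j
  proof (rule ccontr)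
    assume "\<not> slope i < slope j"
    moreover have "slope i \<noteq> slope j"
    proof
      assume "slope i = slope j"
      then have "i = j" using slope_inj[of i j v] that by simp
      with that show False by simp
    qed
    ultimately have "(- 1) * slope i < (- 1) * slope j" by simp
    then have top: "apex (- 1) n v" using that v unfolding apex_def by blast
    obtain p where p: "p \<in> cell n" using ne by blast
    then have "p \<noteq> v" using cell_not_on_line[OF p that(1)] that(3) by auto
    moreover have "p \<in> closed_cell n" using p cell_subset_closed_cell by blast
    ultimately show False using apex_strict_min[OF top, of p] apex_strict_min[OF v, of p] by simp
  qed
  have b: "of_int (n k) \<le> form k v" "form k v \<le> of_int (n k) + 1" if "k \<in> A" for k
    using that v by (auto simp: closed_cell_def apex_def)
  have "up_edge v l" unfolding up_edge_def
  proof (intro conjI bexI)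
    show "l \<in> A" "form l v \<in> \<int>" using lA by auto
    show "form j0 v \<in> \<int>" "j0 \<in> A" using ij by auto
    show "slope l < slope j0" using lt lA ij by blast
  qed
  moreover have "n k = fan_cell v l k" if k: "k \<in> A" for k
  proof (cases "form k v = of_int (n k) + 1")
    case True
    then have "slope l < slope k" using lt lA k by blast
    then show ?thesis using True by (simp add: fan_cell_def)
  next
    case False
    then have lt1: "form k v < of_int (n k) + 1" using b[OF k] by simp
    then have "\<lfloor>form k v\<rfloor> = n k" using b[OF k] by (intro floor_unique) auto
    moreover have "\<not> slope l < slope k" if "form k v \<in> \<int>"
    proof -
      have "form k v = of_int (n k)"
        using between_consecutive_ints_not_Ints[of "n k" "form k v"] that lt1 b[OF k] by force
      then show ?thesis using l(2)[of k] k by (simp add: L_def)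
    qed
    ultimately show ?thesis by (auto simp: fan_cell_def)
  qed
  ultimately show ?thesis using that by blast
qed

text \<open>If \<open>slope l < slope l'\<close>, the codes differ at \<open>l'\<close>, which is a
  right bound in the first fan cell and a left bound in the second.\<close>

lemma fan_cell_inj:
  assumes "up_edge v l" "up_edge v l'" "\<And>k. k \<in> A \<Longrightarrow> fan_cell v l k = fan_cell v l' k"
  shows "l = l'"
proof -
  have "\<not> slope l < slope l'" "\<not> slope l' < slope l"
    using assms(3)[of l] assms(3)[of l'] assms(1,2) by (auto simp: fan_cell_def up_edge_def)
  then show ?thesis using slope_inj[of l l' v] assms(1,2) by (auto simp: up_edge_def)
qed

subsection \<open>Counting chambers\<close>

lemma torus_map_in_vertices_iff: "torus_map v \<in> vertices A \<longleftrightarrow> on_two_lines v"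
  unfolding vertices_def on_two_lines_def using torus_map_in_line_iff by blast

definition lift :: "complex \<times> complex \<Rightarrow> real \<times> real" where
  "lift x = (SOME v. torus_map v = x)"

lemma vertex_lift:
  assumes "x \<in> vertices A" shows "torus_map (lift x) = x" "on_two_lines (lift x)"
proof -
  have "x \<in> torus" using assms line_subset_torus by (auto simp: vertices_def)
  then have "\<exists>v. torus_map v = x" by (auto simp: torus_def)
  then show "torus_map (lift x) = x" unfolding lift_def by (rule someI_ex)
  then show "on_two_lines (lift x)" using assms by (simp flip: torus_map_in_vertices_iff)
qed

lemma on_two_lines_add_int: "on_two_lines (v + (of_int i, of_int j)) \<longleftrightarrow> on_two_lines v"
  by (simp flip: torus_map_in_vertices_iff)

lemma up_edge_add_int: "up_edge (v + (of_int i, of_int j)) l \<longleftrightarrow> up_edge v l"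
  by (simp add: up_edge_def form_add_int_Ints)

text \<open>Every vertex has a lift in the unit square, where all forms are bounded. That lift is a
  corner of a cell whose code lies in a finite set, and each cell has finitely many corners.\<close>

lemma finite_vertices: "finite (vertices A)"
proof -
  define M where "M l = \<lceil>\<bar>real_of_int (a l)\<bar> + \<bar>of_int (b l)\<bar> + \<bar>c l\<bar>\<rceil>" for l
  define N where "N = PiE A (\<lambda>l. {- M l..M l})"
  have "finite N" unfolding N_def using finite_A by (intro finite_PiE) auto
  then have "finite (\<Union>n\<in>N. torus_map ` corners n)" using finite_corners by blast
  moreover have "vertices A \<subseteq> (\<Union>n\<in>N. torus_map ` corners n)"
  proof
    fix x assume "x \<in> vertices A"
    then obtain w where w: "torus_map w = x" "on_two_lines w" using vertex_lift by blast
    define v where "v = w + (of_int (- \<lfloor>fst w\<rfloor>), of_int (- \<lfloor>snd w\<rfloor>))"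
    have v: "torus_map v = x" "on_two_lines v"
      using w unfolding v_def torus_map_add_int on_two_lines_add_int by auto
    have box: "\<bar>fst v\<bar> \<le> 1" "\<bar>snd v\<bar> \<le> 1"
      unfolding v_def fst_add snd_add fst_conv snd_conv of_int_minus
      using floor_correct[of "fst w"] floor_correct[of "snd w"] by linarith+
    \<comment> \<open>The restriction to \<open>A\<close> fixes the code elsewhere, so that it
      belongs to the finite product \<open>N\<close>.\<close>
    define n where "n = restrict (side_cell True v) A"
    have "v \<in> corners n"
      using v(2) in_closed_side_cell[of n True v] by (simp add: corners_eq n_def)
    moreover have "n \<in> N" unfolding N_def n_def
    proof (intro restrict_PiE_iff[THEN iffD2] ballI)
      fix l assume "l \<in> A"
      have "\<bar>of_int (a l) * fst v\<bar> \<le> \<bar>real_of_int (a l)\<bar> * 1" "\<bar>of_int (b l) * snd v\<bar> \<le> \<bar>real_of_int (b l)\<bar> * 1"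
        unfolding abs_mult using box by (intro mult_left_mono; simp)+
      then have "\<bar>form l v\<bar> \<le> \<bar>real_of_int (a l)\<bar> + \<bar>of_int (b l)\<bar> + \<bar>c l\<bar>"
        unfolding form_def lin_def by linarith
      also have "\<dots> \<le> of_int (M l)" unfolding M_def by (rule le_of_int_ceiling)
      finally have "- of_int (M l) \<le> form l v" "form l v \<le> of_int (M l)" by auto
      then have "- M l \<le> \<lfloor>form l v\<rfloor>" "\<lfloor>form l v\<rfloor> \<le> M l"
        by (simp add: le_floor_iff, metis floor_mono floor_of_int)
      then show "side_cell True v l \<in> {- M l..M l}" by (simp add: side_cell_simps)
    qed
    ultimately show "x \<in> (\<Union>n\<in>N. torus_map ` corners n)" using v(1) by blast
  qed
  ultimately show ?thesis by (rule finite_subset[rotated])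
qed

lemma vertex_degree_eq:
  "vertex_degree A (torus_map v) = card {l \<in> A. form l v \<in> \<int>}"
proof -
  have "{l \<in> A. torus_map v \<in> l} = {l \<in> A. form l v \<in> \<int>}" using torus_map_in_line_iff by blast
  then show ?thesis by (simp add: vertex_degree_def)
qed

lemma vertex_degree_ge_2:
  assumes "x \<in> vertices A" shows "2 \<le> vertex_degree A x"
proof -
  obtain i j where "i \<in> A" "j \<in> A" "i \<noteq> j" "x \<in> i" "x \<in> j" using assms by (auto simp: vertices_def)
  then have "{i, j} \<subseteq> {l \<in> A. x \<in> l}" "card {i, j} = 2" by auto
  then show ?thesis unfolding vertex_degree_def using finite_A
    by (metis card_mono finite_Collect_conjI Collect_mem_eq)
qed

lemma card_up_edges:
  assumes "on_two_lines v"
  shows "card {l. up_edge v l} = vertex_degree A (torus_map v) - 1"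
proof -
  let ?S = "{l \<in> A. form l v \<in> \<int>}"
  have "{l. up_edge v l} = {l \<in> ?S. \<exists>k\<in>?S. slope l < slope k}" by (auto simp: up_edge_def)
  also have "card \<dots> = card ?S - 1"
  proof (rule card_not_maximal)
    show "finite ?S" using finite_A by simp
    show "?S \<noteq> {}" using assms unfolding on_two_lines_def by blast
    show "inj_on slope ?S" using slope_inj by (intro inj_onI) blast
  qed
  finally show ?thesis by (simp add: vertex_degree_eq)
qed

text \<open>The inverse sends a chamber to the image of its lowest corner and to its left bound
  there. For injectivity, codes of one chamber differ by a translation; uniqueness of the apex
  matches the lifts, and then \<open>fan_cell_inj\<close> matches the lines.\<close>

lemma fan_chamber_bij:
  "bij_betw (\<lambda>(x, l). chamber (fan_cell (lift x) l))
     (SIGMA x:vertices A. {l. up_edge (lift x) l}) (chambers A)"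
  unfolding bij_betw_def
proof (intro conjI equalityI subsetI)
  show "inj_on (\<lambda>(x, l). chamber (fan_cell (lift x) l)) (SIGMA x:vertices A. {l. up_edge (lift x) l})"
  proof (rule inj_onI, clarify)
    fix x l x' l'
    assume x: "x \<in> vertices A" "up_edge (lift x) l" and x': "x' \<in> vertices A" "up_edge (lift x') l'"
      and eq: "chamber (fan_cell (lift x) l) = chamber (fan_cell (lift x') l')"
    obtain i j where "\<And>k. k \<in> A \<Longrightarrow> fan_cell (lift x') l' k = shift (fan_cell (lift x) l) i j k"
      using chamber_eqE[OF eq fan_cell_nonempty[OF x(2)]] by metis
    define v where "v = lift x + (of_int i, of_int j)"
    have up: "up_edge v l" using x(2) by (simp add: v_def up_edge_add_int)
    have code: "fan_cell (lift x') l' k = fan_cell v l k" if "k \<in> A" for k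
      using that \<open>\<And>k. k \<in> A \<Longrightarrow> fan_cell (lift x') l' k = _\<close> by (simp add: v_def fan_cell_add_int)
    have "apex 1 (fan_cell v l) (lift x')"
      using fan_cell_apex[OF x'(2)] code by (simp add: apex_def closed_cell_def)
    then have v: "lift x' = v" using fan_cell_apex[OF up] by (rule apex_unique)
    have "x = torus_map v" using vertex_lift(1)[OF x(1)] by (simp add: v_def)
    moreover have "x' = torus_map v" using vertex_lift(1)[OF x'(1)] by (simp add: v)
    moreover have "l' = l" using fan_cell_inj[of v l' l] x'(2) up code by (simp add: v)
    ultimately show "x = x' \<and> l = l'" by simp
  qed
next
  fix C assume "C \<in> (\<lambda>(x, l). chamber (fan_cell (lift x) l)) ` (SIGMA x:vertices A. {l. up_edge (lift x) l})"
  then obtain x l where "C = chamber (fan_cell (lift x) l)" "up_edge (lift x) l" by auto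
  then show "C \<in> chambers A" using fan_cell_nonempty unfolding chambers_eq by blast
next
  fix C assume "C \<in> chambers A"
  then obtain n where n: "C = chamber n" "cell n \<noteq> {}" by (auto simp: chambers_eq)
  then obtain v where v: "apex 1 n v" using apex_exists by blast
  then obtain l where l: "up_edge v l" "\<And>k. k \<in> A \<Longrightarrow> n k = fan_cell v l k"
    using apex_fan_cellE n(2) by metis
  define x where "x = torus_map v"
  have x: "x \<in> vertices A" using apex_on_two_lines[OF v] by (simp add: x_def torus_map_in_vertices_iff)
  have "torus_map (lift x) = torus_map v" using vertex_lift(1)[OF x] by (simp add: x_def)
  then obtain i j where ij: "v = lift x + (of_int i, of_int j)" by (auto simp: torus_map_eq_iff)
  have "chamber n = chamber (shift (fan_cell (lift x) l) i j)"
    using l(2) by (intro chamber_cong) (simp add: ij fan_cell_add_int)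
  then have "C = chamber (fan_cell (lift x) l)" using n(1) by (simp add: chamber_shift)
  moreover have "up_edge (lift x) l" using l(1) by (simp add: ij up_edge_add_int)
  ultimately show "C \<in> (\<lambda>(x, l). chamber (fan_cell (lift x) l)) ` (SIGMA x:vertices A. {l. up_edge (lift x) l})"
    using x by (intro image_eqI[of _ _ "(x, l)"]) auto
qed

lemma card_chambers: "card (chambers A) = (\<Sum>x\<in>vertices A. vertex_degree A x - 1)"
proof -
  have fin: "finite {l. up_edge v l}" for v
    by (rule finite_subset[OF _ finite_A]) (auto simp: up_edge_def)
  have "card (chambers A) = card (SIGMA x:vertices A. {l. up_edge (lift x) l})"
    using bij_betw_same_card[OF fan_chamber_bij] by simp
  also have "\<dots> = (\<Sum>x\<in>vertices A. card {l. up_edge (lift x) l})"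
    using finite_vertices fin by (intro card_SigmaI) auto
  also have "\<dots> = (\<Sum>x\<in>vertices A. vertex_degree A x - 1)"
    by (intro sum.cong refl) (simp add: card_up_edges vertex_lift)
  finally show ?thesis .
qed

lemma card_chambers_ge: "card (vertices A) \<le> card (chambers A)"
proof -
  have "(\<Sum>x\<in>vertices A. 1) \<le> (\<Sum>x\<in>vertices A. vertex_degree A x - 1)"
    using vertex_degree_ge_2 by (intro sum_mono) force
  then show ?thesis by (simp add: card_chambers)
qed

lemma card_chambers_eq_iff_simple:
  "card (chambers A) = card (vertices A) \<longleftrightarrow> simple_arrangement A"
proof -
  have deg: "1 \<le> vertex_degree A x - 1" if "x \<in> vertices A" for x using vertex_degree_ge_2[OF that] by simp
  have "card (chambers A) = card (vertices A)
      \<longleftrightarrow> (\<Sum>x\<in>vertices A. vertex_degree A x - 1) = (\<Sum>x\<in>vertices A. 1)"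
    by (simp add: card_chambers)
  also have "\<dots> \<longleftrightarrow> (\<forall>x\<in>vertices A. vertex_degree A x - 1 = 1)"
  proof
    assume eq: "(\<Sum>x\<in>vertices A. vertex_degree A x - 1) = (\<Sum>x\<in>vertices A. 1)"
    show "\<forall>x\<in>vertices A. vertex_degree A x - 1 = 1"
    proof (rule ccontr)
      assume "\<not> (\<forall>x\<in>vertices A. vertex_degree A x - 1 = 1)"
      then have "\<exists>x\<in>vertices A. 1 < vertex_degree A x - 1" using deg by force
      then have "(\<Sum>x\<in>vertices A. 1) < (\<Sum>x\<in>vertices A. vertex_degree A x - 1)"
        using deg finite_vertices by (intro sum_strict_mono_ex1) auto
      with eq show False by simp
    qed
  qed simp
  also have "\<dots> \<longleftrightarrow> simple_arrangement A"
    unfolding simple_arrangement_def using vertex_degree_ge_2 by force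
  finally show ?thesis .
qed

section \<open>Side corners, the upper bound and the simplicial case\<close>

text \<open>The pairs are the two side corners at each vertex: \<open>True\<close> selects the
  chamber to the right of the vertex, \<open>False\<close> the one to the left.\<close>

definition side_chamber :: "(complex \<times> complex) \<times> bool \<Rightarrow> (complex \<times> complex) set" where
  "side_chamber = (\<lambda>(x, t). chamber (side_cell t (lift x)))"

text \<open>Replaces the arbitrary choice made by \<open>lift\<close> with the lift of
  \<open>x\<close> that is a side corner of the given cell \<open>n\<close> itself.\<close>

lemma side_chamber_eqE:
  assumes "x \<in> vertices A" "side_chamber (x, t) = chamber n"
  obtains v where "torus_map v = x" "on_two_lines v" "\<And>l. l \<in> A \<Longrightarrow> n l = side_cell t v l"
proof -
  have "chamber (side_cell t (lift x)) = chamber n" using assms(2) by (simp add: side_chamber_def)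
  then obtain i j where "\<And>l. l \<in> A \<Longrightarrow> n l = shift (side_cell t (lift x)) i j l"
    using chamber_eqE[OF _ side_cell_nonempty] by metis
  then have "\<And>l. l \<in> A \<Longrightarrow> n l = side_cell t (lift x + (of_int i, of_int j)) l"
    by (simp add: side_cell_add_int)
  moreover have "torus_map (lift x + (of_int i, of_int j)) = x" "on_two_lines (lift x + (of_int i, of_int j))"
    using vertex_lift[OF assms(1)] by (simp_all add: on_two_lines_add_int)
  ultimately show ?thesis using that by blast
qed

lemma side_chamber_eqI:
  assumes "on_two_lines v" "\<And>l. l \<in> A \<Longrightarrow> n l = side_cell t v l"
  shows "side_chamber (torus_map v, t) = chamber n"
proof -
  have "torus_map (lift (torus_map v)) = torus_map v"
    using assms(1) vertex_lift(1) torus_map_in_vertices_iff by blast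
  then obtain i j where ij: "v = lift (torus_map v) + (of_int i, of_int j)" by (auto simp: torus_map_eq_iff)
  have "n l = shift (side_cell t (lift (torus_map v))) i j l" if "l \<in> A" for l
    using assms(2)[OF that] ij side_cell_add_int by metis
  then have "chamber n = chamber (shift (side_cell t (lift (torus_map v))) i j)" by (rule chamber_cong)
  then show ?thesis by (simp add: chamber_shift side_chamber_def)
qed

lemma side_chamber_image: "side_chamber ` (vertices A \<times> UNIV) = chambers A"
proof (intro equalityI subsetI)
  fix C assume "C \<in> side_chamber ` (vertices A \<times> UNIV)"
  then obtain x t where "C = chamber (side_cell t (lift x))" by (auto simp: side_chamber_def)
  then show "C \<in> chambers A" using side_cell_nonempty unfolding chambers_eq by blast
next
  fix C assume "C \<in> chambers A"
  then obtain n where n: "C = chamber n" "cell n \<noteq> {}" by (auto simp: chambers_eq)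
  have "card (side_corners n) \<noteq> 0" using card_corners(2)[OF n(2)] card_corners_ge_3[OF n(2)] by linarith
  then obtain q where "q \<in> side_corners n" by (metis card.empty ex_in_conv)
  then obtain t where q: "on_two_lines q" "\<And>l. l \<in> A \<Longrightarrow> n l = side_cell t q l"
    by (auto simp: side_corners_def)
  then have "side_chamber (torus_map q, t) = C" unfolding n(1) by (rule side_chamber_eqI)
  moreover have "torus_map q \<in> vertices A" using q(1) torus_map_in_vertices_iff by blast
  ultimately show "C \<in> side_chamber ` (vertices A \<times> UNIV)" by blast
qed

lemma card_vertices_Times_bool: "card (vertices A \<times> (UNIV :: bool set)) = 2 * card (vertices A)"
  by (simp add: card_cartesian_product)

lemma card_chambers_le: "card (chambers A) \<le> 2 * card (vertices A)"
proof -
  have "card (side_chamber ` (vertices A \<times> UNIV)) \<le> card (vertices A \<times> (UNIV :: bool set))"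
    using finite_vertices by (intro card_image_le) auto
  then show ?thesis by (simp only: side_chamber_image card_vertices_Times_bool)
qed

text \<open>Two side corners of one cell have the same chamber, so by injectivity they lie over the
  same vertex with the same \<open>t\<close>. They differ by a translation that fixes the code,
  hence agree, and \<open>k - 2 = 1\<close>.\<close>

lemma inj_side_chamber_imp_simplicial:
  assumes inj: "inj_on side_chamber (vertices A \<times> UNIV)"
  shows "simplicial_arrangement A"
  unfolding simplicial_arrangement_def
proof
  fix C assume "C \<in> chambers A"
  then obtain n where n: "C = chamber n" "cell n \<noteq> {}" by (auto simp: chambers_eq)
  have "p = q" if pq: "p \<in> side_corners n" "q \<in> side_corners n" for p q
  proof -
    obtain t where p: "on_two_lines p" "\<And>l. l \<in> A \<Longrightarrow> n l = side_cell t p l"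
      using pq(1) by (auto simp: side_corners_def)
    obtain t' where q: "on_two_lines q" "\<And>l. l \<in> A \<Longrightarrow> n l = side_cell t' q l"
      using pq(2) by (auto simp: side_corners_def)
    have "side_chamber (torus_map p, t) = side_chamber (torus_map q, t')"
      using side_chamber_eqI p q by metis
    then have "(torus_map p, t) = (torus_map q, t')"
      using p(1) q(1) by (intro inj_onD[OF inj]) (auto simp: torus_map_in_vertices_iff)
    then obtain i j where ij: "q = p + (of_int i, of_int j)" and [simp]: "t' = t"
      by (auto simp: torus_map_eq_iff)
    have "shift n i j l = n l" if "l \<in> A" for l
      using q(2)[OF that] p(2)[OF that] by (simp add: ij side_cell_add_int shift_def)
    then have "i = 0 \<and> j = 0" by (rule shift_trivial)
    then show ?thesis using ij by (simp add: prod_eq_iff)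
  qed
  then have "card (side_corners n) \<le> 1"
    using card_corners(1)[OF n(2)] by (simp add: card_le_Suc0_iff_eq)
  then have "card (corners n) = 3" using card_corners(2)[OF n(2)] card_corners_ge_3[OF n(2)] by simp
  then show "toric_kgon 3 C" unfolding n(1) by (rule toric_3gon_chamberI[OF n(2)])
qed

lemma simplicial_imp_inj_side_chamber:
  assumes simplicial: "simplicial_arrangement A"
  shows "inj_on side_chamber (vertices A \<times> UNIV)"
proof (rule inj_onI, clarify)
  fix x t x' t'
  assume x: "x \<in> vertices A" and x': "x' \<in> vertices A" and eq: "side_chamber (x, t) = side_chamber (x', t')"
  have "side_chamber (x, t) \<in> chambers A" using x side_chamber_image by blast
  moreover have "toric_kgon 3 (side_chamber (x, t))"
    using calculation simplicial by (simp add: simplicial_arrangement_def)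
  ultimately obtain n where n: "cell n \<noteq> {}" "side_chamber (x, t) = chamber n" "card (corners n) = 3"
    by (rule toric_3gon_chamberD)
  obtain v where v: "torus_map v = x" "on_two_lines v" "\<And>l. l \<in> A \<Longrightarrow> n l = side_cell t v l"
    using side_chamber_eqE[OF x n(2)] by metis
  obtain v' where v': "torus_map v' = x'" "on_two_lines v'" "\<And>l. l \<in> A \<Longrightarrow> n l = side_cell t' v' l"
    using side_chamber_eqE[OF x'] n(2) eq by metis
  have "card (side_corners n) \<le> Suc 0" using card_corners(2)[OF n(1)] n(3) by simp
  moreover have "v \<in> side_corners n" "v' \<in> side_corners n"
    using v v' unfolding side_corners_def by blast+
  ultimately have "v = v'" using card_corners(1)[OF n(1)] by (simp add: card_le_Suc0_iff_eq)
  moreover have "t = t'" using side_cell_unique[OF v(2)] v(3) v'(3) \<open>v = v'\<close> by metis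
  ultimately show "x = x' \<and> t = t'" using v(1) v'(1) by simp
qed

lemma card_chambers_eq_iff_simplicial:
  "card (chambers A) = 2 * card (vertices A) \<longleftrightarrow> simplicial_arrangement A"
proof -
  have "finite (vertices A \<times> (UNIV :: bool set))" using finite_vertices by simp
  then have "inj_on side_chamber (vertices A \<times> UNIV) \<longleftrightarrow> card (chambers A) = 2 * card (vertices A)"
    using inj_on_iff_eq_card[of "vertices A \<times> (UNIV :: bool set)" side_chamber]
    by (simp only: side_chamber_image card_vertices_Times_bool)
  then show ?thesis
    using inj_side_chamber_imp_simplicial simplicial_imp_inj_side_chamber by blast
qed

end

section \<open>Oriented equations for a given arrangement\<close>

lemma toric_line_oriented_rep:
  assumes "is_toric_line l"
  shows "\<exists>a b c. coprime a b \<and> 0 < real_of_int a + of_int b * sqrt 2 \<and> l = toric_line a b c"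
proof -
  obtain a b c where l: "coprime a b" "l = toric_line a b c" using assms by (auto simp: is_toric_line_def)
  show ?thesis
  proof (cases "0 < real_of_int a + of_int b * sqrt 2")
    case True
    then show ?thesis using l by blast
  next
    case False
    then have "0 < real_of_int (- a) + of_int (- b) * sqrt 2"
      using coprime_add_sqrt2_neq_0[OF l(1)] by simp
    moreover have "coprime (- a) (- b)" using l(1) by simp
    moreover have "l = toric_line (- a) (- b) (- c)" using l(2) toric_line_uminus by simp
    ultimately show ?thesis by blast
  qed
qed

text \<open>Essentiality is given for some coprime equations of two lines but required for the
  chosen oriented ones. Equations of the same toric line have equal normals up to sign, so
  non-parallelism carries over.\<close>

lemma toric_arrangement_oriented:
  assumes "toric_arrangement A"
  obtains a b c where "oriented_arrangement A a b c"
proof -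
  have "\<forall>l\<in>A. \<exists>a b c. coprime a b \<and> 0 < real_of_int a + of_int b * sqrt 2 \<and> l = toric_line a b c"
    using assms toric_line_oriented_rep by (auto simp: toric_arrangement_def)
  then obtain a b c where abc: "\<And>l. l \<in> A \<Longrightarrow> coprime (a l) (b l)"
    "\<And>l. l \<in> A \<Longrightarrow> 0 < real_of_int (a l) + of_int (b l) * sqrt 2"
    "\<And>l. l \<in> A \<Longrightarrow> l = toric_line (a l) (b l) (c l)" by metis
  obtain l1 l2 a1 b1 c1 a2 b2 c2 where l: "l1 \<in> A" "l2 \<in> A" "coprime a1 b1" "coprime a2 b2"
    "l1 = toric_line a1 b1 c1" "l2 = toric_line a2 b2 c2"
    "\<not> ((a1 = a2 \<and> b1 = b2) \<or> (a1 = - a2 \<and> b1 = - b2))"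
    using assms unfolding toric_arrangement_def by metis
  have rep: "a l = a' \<and> b l = b' \<or> a l = - a' \<and> b l = - b'"
    if "l \<in> A" "coprime a' b'" "l = toric_line a' b' c'" for l a' b' c'
  proof (rule coprime_cross_eq_cases)
    show "coprime (a l) (b l)" "coprime a' b'" using that abc by auto
    have "toric_line (a l) (b l) (c l) = toric_line a' b' c'" using abc(3) that by metis
    then show "a l * b' = a' * b l" using toric_line_eq_imp_parallel abc(1) that by blast
  qed
  have "a l1 * b l2 \<noteq> a l2 * b l1"
  proof
    assume "a l1 * b l2 = a l2 * b l1"
    then have "a l1 = a l2 \<and> b l1 = b l2 \<or> a l1 = - a l2 \<and> b l1 = - b l2"
      by (intro coprime_cross_eq_cases abc l)
    then show False using rep[OF l(1,3,5)] rep[OF l(2,4,6)] l(7) by auto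
  qed
  then have "oriented_arrangement A a b c"
    using assms abc l(1,2) by unfold_locales (auto simp: toric_arrangement_def)
  then show ?thesis by (rule that)
qed

section \<open>Arrangements with prescribed numbers\<close>

lemma diff_fractions_Ints_imp_eq:
  fixes m i j :: nat
  assumes "i < m" "j < m" "real i / real m - real j / real m \<in> \<int>"
  shows "i = j"
proof -
  obtain z :: int where z: "real i / real m - real j / real m = of_int z"
    using assms(3) by (auto elim: Ints_cases)
  then have "real i - real j = real m * of_int z" using assms(1) by (simp add: field_simps)
  then have "real_of_int (int i - int j) = of_int (int m * z)" by simp
  then have "int i - int j = int m * z" by (simp only: of_int_eq_iff)
  then have "int m dvd int i - int j" by simp
  moreover have "\<bar>int i - int j\<bar> < int m" using assms(1,2) by linarith
  ultimately have "int i - int j = 0" using dvd_imp_le_int[of "int i - int j" "int m"] by linarith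
  then show ?thesis by simp
qed

text \<open>On the lines \<open>y = 0\<close> and \<open>y = m x\<close>, which meet in the \<open>m\<close> points \<open>(j / m, 0)\<close>, each of the
  \<open>k\<close> vertical lines passes through one of these points and creates no other vertex.\<close>
lemma arrangement_exists:
  fixes m k :: nat
  assumes m: "0 < m" and k: "k \<le> m"
  shows "\<exists>A. toric_arrangement A \<and> card (vertices A) = m \<and> card (chambers A) = m + k"
proof -
  define H where "H = toric_line 0 1 0"
  define D where "D = toric_line (int m) (- 1) 0"
  define V where "V j = toric_line 1 0 (real j / real m)" for j :: nat
  define A where "A = {H, D} \<union> V ` {..<k}"
  define P where "P j = torus_map (real j / real m, 0)" for j :: nat
  have inH: "torus_map p \<in> H \<longleftrightarrow> snd p \<in> \<int>" for p
    unfolding H_def by (subst torus_map_in_toric_line_iff) auto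
  have inD: "torus_map p \<in> D \<longleftrightarrow> real m * fst p - snd p \<in> \<int>" for p
    unfolding D_def by (subst torus_map_in_toric_line_iff) auto
  have inV: "torus_map p \<in> V j \<longleftrightarrow> fst p - real j / real m \<in> \<int>" for p j
    unfolding V_def by (subst torus_map_in_toric_line_iff) auto
  have HD: "H \<noteq> D"
    using toric_line_eq_imp_parallel[of 0 1 "int m" "- 1" 0 0] m unfolding H_def D_def by auto
  have VH: "V j \<noteq> H" for j
    using toric_line_eq_imp_parallel[of 1 0 0 1 "real j / real m" 0] unfolding H_def V_def by auto
  have VD: "V j \<noteq> D" for j
    using toric_line_eq_imp_parallel[of 1 0 "int m" "- 1" "real j / real m" 0] unfolding D_def V_def by auto
  have PH: "P j \<in> H" and PD: "P j \<in> D" for j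
    unfolding P_def inH inD using m by simp_all
  have PV: "P j \<in> V i \<longleftrightarrow> i = j" if "i < m" "j < m" for i j
    unfolding P_def inV using diff_fractions_Ints_imp_eq[OF that(2,1)] by auto
  have V_inj: "i = j" if "i < k" "j < k" "torus_map p \<in> V i" "torus_map p \<in> V j" for i j p
  proof -
    have "(fst p - real i / real m) - (fst p - real j / real m) \<in> \<int>"
      using that(3,4) unfolding inV by (rule Ints_diff)
    then have "real j / real m - real i / real m \<in> \<int>" by simp
    then show ?thesis using diff_fractions_Ints_imp_eq[of j m i] that(1,2) k by simp
  qed
  have arr: "toric_arrangement A"
    unfolding toric_arrangement_def
  proof (intro conjI)
    show "finite A" by (simp add: A_def)
    have "is_toric_line H" "is_toric_line D" "is_toric_line (V j)" for j
      unfolding is_toric_line_def H_def D_def V_def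
      by (rule exI[of _ 0], rule exI[of _ 1], force, rule exI[of _ "int m"], rule exI[of _ "- 1"], force,
          rule exI[of _ 1], rule exI[of _ 0], force)
    then show "\<forall>l\<in>A. is_toric_line l" by (auto simp: A_def)
    show "\<exists>l1\<in>A. \<exists>l2\<in>A. \<exists>a1 b1 c1 a2 b2 c2. coprime a1 b1 \<and> coprime a2 b2 \<and>
        l1 = toric_line a1 b1 c1 \<and> l2 = toric_line a2 b2 c2 \<and>
        \<not> ((a1 = a2 \<and> b1 = b2) \<or> (a1 = - a2 \<and> b1 = - b2))"
    proof (intro bexI exI conjI)
      show "H = toric_line 0 1 0" "D = toric_line (int m) (- 1) 0" by (simp_all add: H_def D_def)
      show "H \<in> A" "D \<in> A" by (simp_all add: A_def)
      show "\<not> ((0 = int m \<and> 1 = (- 1 :: int)) \<or> (0 = - int m \<and> 1 = - (- 1 :: int)))" using m by simp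
    qed auto
  qed
  have verts: "vertices A = P ` {..<m}"
  proof (intro equalityI subsetI)
    fix x assume "x \<in> P ` {..<m}"
    then show "x \<in> vertices A" using PH PD HD unfolding vertices_def A_def by blast
  next
    fix x assume x: "x \<in> vertices A"
    obtain a b c where "oriented_arrangement A a b c" using toric_arrangement_oriented[OF arr] .
    then interpret oriented_arrangement A a b c .
    obtain p where p: "x = torus_map p" using vertex_lift(1)[OF x] by metis
    obtain l l' where l: "l \<in> A" "l' \<in> A" "l \<noteq> l'" "torus_map p \<in> l" "torus_map p \<in> l'"
      using x p by (auto simp: vertices_def)
    have mV: "real m * fst p \<in> \<int>" if "torus_map p \<in> V j" for j
    proof -
      have "real m * (fst p - real j / real m) + real j \<in> \<int>"
        using that unfolding inV by (intro Ints_add Ints_mult) auto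
      then show ?thesis using m by (simp add: right_diff_distrib)
    qed
    have "(torus_map p \<in> H \<and> torus_map p \<in> D) \<or> (\<exists>j. torus_map p \<in> V j \<and> (torus_map p \<in> H \<or> torus_map p \<in> D))"
    proof -
      \<comment> \<open>The vertical lines are pairwise disjoint, so \<open>H\<close> or
        \<open>D\<close> is among the two lines meeting at \<open>p\<close>.\<close>
      have two: "\<not> (\<exists>i<k. \<exists>j<k. l = V i \<and> l' = V j)" using l(3-5) V_inj by blast
      have "l = H \<or> l = D \<or> (\<exists>j<k. l = V j)" "l' = H \<or> l' = D \<or> (\<exists>j<k. l' = V j)"
        using l(1,2) by (auto simp: A_def)
      then show ?thesis using two l(3-5) by metis
    qed
    then have int: "snd p \<in> \<int> \<and> real m * fst p \<in> \<int>"
    proof (elim disjE exE conjE)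
      assume "torus_map p \<in> H" "torus_map p \<in> D"
      then have y: "snd p \<in> \<int>" and "real m * fst p - snd p \<in> \<int>" by (simp_all only: inH inD)
      then have "(real m * fst p - snd p) + snd p \<in> \<int>" by (intro Ints_add)
      with y show ?thesis by simp
    next
      fix j assume "torus_map p \<in> V j" "torus_map p \<in> H"
      then show ?thesis using mV inH by blast
    next
      fix j assume "torus_map p \<in> V j" "torus_map p \<in> D"
      then have x: "real m * fst p \<in> \<int>" and "real m * fst p - snd p \<in> \<int>"
        using mV by (blast, simp only: inD)
      then have "real m * fst p - (real m * fst p - snd p) \<in> \<int>" by (rule Ints_diff)
      with x show ?thesis by simp
    qed
    then obtain s t :: int where st: "snd p = of_int s" "real m * fst p = of_int t"
      by (auto elim!: Ints_cases)
    \<comment> \<open>The remainder modulo \<open>m\<close> selects the point \<open>P j\<close>;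
      the quotient is absorbed by an integer translation.\<close>
    define j where "j = nat (t mod int m)"
    have j: "j < m" "int j = t mod int m" using m by (simp_all add: j_def nat_less_iff)
    have "t = int m * (t div int m) + int j" unfolding j(2) by simp
    then have "real m * fst p = real m * of_int (t div int m) + real j"
      unfolding st(2) by (metis of_int_add of_int_mult of_int_of_nat_eq)
    then have "fst p = real j / real m + of_int (t div int m)" using m by (simp add: field_simps)
    then have "p = (real j / real m, 0) + (of_int (t div int m), of_int s)"
      using st(1) by (simp add: prod_eq_iff)
    then have "x = P j" unfolding p P_def by (simp only: torus_map_add_int)
    then show "x \<in> P ` {..<m}" using j(1) by blast
  qed
  have P_inj: "inj_on P {..<m}"
  proof (rule inj_onI)
    fix i j assume ij: "i \<in> {..<m}" "j \<in> {..<m}" "P i = P j"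
    then have "P j \<in> V i" using PV[of i i] by simp
    then show "i = j" using PV ij by simp
  qed
  \<comment> \<open>The first \<open>k\<close> points carry a third line and contribute 2 chambers
    each, the others 1.\<close>
  have deg: "vertex_degree A (P j) - 1 = 1 + (if j < k then 1 else 0)" if "j < m" for j
  proof -
    have "{l \<in> A. P j \<in> l} = {H, D} \<union> (if j < k then {V j} else {})"
      using PH PD PV that k unfolding A_def by auto
    then show ?thesis using HD VH[of j] VD[of j] by (auto simp: vertex_degree_def)
  qed
  have "card (vertices A) = m" by (simp add: verts card_image P_inj)
  moreover have "card (chambers A) = m + k"
  proof -
    obtain a b c where "oriented_arrangement A a b c" using toric_arrangement_oriented[OF arr] .
    then have "card (chambers A) = (\<Sum>x\<in>vertices A. vertex_degree A x - 1)"
      by (rule oriented_arrangement.card_chambers)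
    also have "\<dots> = (\<Sum>j<m. vertex_degree A (P j) - 1)"
      unfolding verts using P_inj by (simp add: sum.reindex)
    also have "\<dots> = (\<Sum>j<m. 1 + (if j < k then 1 else 0))" using deg by (intro sum.cong) auto
    also have "\<dots> = (\<Sum>j<m. 1) + (\<Sum>j<m. if j < k then 1 else 0)" by (rule sum.distrib)
    also have "\<dots> = m + card ({..<m} \<inter> {j. j < k})" by (simp add: sum.If_cases)
    also have "{..<m} \<inter> {j. j < k} = {..<k}" using k by auto
    finally show ?thesis by simp
  qed
  ultimately show ?thesis using arr by blast
qed

theorem mainTheorem5:
  shows "(\<forall>f0 f2 :: nat. 0 < f0 \<longrightarrow> 0 < f2 \<longrightarrow>
            ((\<exists>A. toric_arrangement A \<and> card (vertices A) = f0 \<and> card (chambers A) = f2)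
              \<longleftrightarrow> f0 \<le> f2 \<and> f2 \<le> 2 * f0))
       \<and> (\<forall>A. toric_arrangement A \<longrightarrow>
            (card (chambers A) = card (vertices A) \<longleftrightarrow> simple_arrangement A) \<and>
            (card (chambers A) = 2 * card (vertices A) \<longleftrightarrow> simplicial_arrangement A))"
proof (intro conjI allI impI)
  fix f0 f2 :: nat
  assume "0 < f0" "0 < f2"
  show "(\<exists>A. toric_arrangement A \<and> card (vertices A) = f0 \<and> card (chambers A) = f2)
      \<longleftrightarrow> f0 \<le> f2 \<and> f2 \<le> 2 * f0"
  proof
    assume "\<exists>A. toric_arrangement A \<and> card (vertices A) = f0 \<and> card (chambers A) = f2"
    then obtain A where A: "toric_arrangement A" "card (vertices A) = f0" "card (chambers A) = f2"
      by blast
    obtain a b c where "oriented_arrangement A a b c" using toric_arrangement_oriented[OF A(1)] .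
    then show "f0 \<le> f2 \<and> f2 \<le> 2 * f0"
      using oriented_arrangement.card_chambers_ge oriented_arrangement.card_chambers_le A(2,3) by blast
  next
    assume "f0 \<le> f2 \<and> f2 \<le> 2 * f0"
    \<comment> \<open>\<open>f2 - f0\<close> is the number of vertices that must have degree 3; the
      upper bound says that there are enough vertices.\<close>
    then have "f2 - f0 \<le> f0" "f0 + (f2 - f0) = f2" by auto
    then show "\<exists>A. toric_arrangement A \<and> card (vertices A) = f0 \<and> card (chambers A) = f2"
      using arrangement_exists[OF \<open>0 < f0\<close>, of "f2 - f0"] by simp
  qed
next
  fix A assume "toric_arrangement A"
  then obtain a b c where A: "oriented_arrangement A a b c" by (rule toric_arrangement_oriented)
  show "card (chambers A) = card (vertices A) \<longleftrightarrow> simple_arrangement A"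
    by (rule oriented_arrangement.card_chambers_eq_iff_simple[OF A])
  show "card (chambers A) = 2 * card (vertices A) \<longleftrightarrow> simplicial_arrangement A"
    by (rule oriented_arrangement.card_chambers_eq_iff_simplicial[OF A])
qed

end
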